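(* Let $\mu$ be a probability measure on $\mathbb{R}$ with finite moments of all orders, with moments $m_n=M_n(\mu)$ and monotone cumulants $r_n=r_n(\mu)$. Then for every $n\ge1$, $$m_n=\sum_{(\pi,\lambda)\in\mathcal{M}(n)}\frac{r(\pi)}{|\pi|!}.$$
   Context: For a probability measure $\mu$ on $\mathbb{R}$ with finite moments, $M_n(\mu)=\int x^n\mu(dx)$. The monotone convolution $\mu\rhd\nu$ is defined by $H_{\mu\rhd\nu}=H_\mu\circ H_\nu$, where $H_\mu(z)=[\int\frac{\mu(dx)}{z-x}]^{-1}$; $\mu^{\rhd N}$ is the $N$-fold monotone convolution of $\mu$ with itself. For each $n\ge1$, $N\mapsto M_n(\mu^{\rhd N})$ is a polynomial in $N$ and the $n$-th monotone cumulant $r_n(\mu)$ is its coefficient of $N$. A partition $\pi$ of $\{1,\dots,n\}$ is non-crossing if there are no blocks $V\ne W$ and $a<b<c<d$ with $a,c\in V$, $b,d\in W$. For blocks $V,W$ of a non-crossing partition, $V$ is in the inner side of $W$ if there exist $w_1,w_2\in W$ with $w_1<v<w_2$ for all $v\in V$. $\mathcal{M}(n)$ is the set of pairs $(\pi,\lambda)$ where $\pi$ is a non-crossing partition of $\{1,\dots,n\}$ and $\lambda$ is a linear order $<_\lambda$ on the blocks of $\pi$ such that whenever $V$ is in the inner side of $W$, $V>_\lambda W$. $|\pi|$ is the number of blocks, and for $\pi=\{V_1,\dots,V_l\}$, $r(\pi):=\prod_{j=1}^l r_{|V_j|}$. *)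

theory Defs
  imports "HOL-Probability.Probability" "HOL-Computational_Algebra.Polynomial"
begin

definition moment :: "real measure \<Rightarrow> nat \<Rightarrow> real" where
  "moment \<mu> n = integral\<^sup>L \<mu> (\<lambda>x. x ^ n)"

definition has_all_moments :: "real measure \<Rightarrow> bool" where
  "has_all_moments \<mu> \<longleftrightarrow> (\<forall>n. integrable \<mu> (\<lambda>x. x ^ n))"

definition real_prob :: "real measure \<Rightarrow> bool" where
  "real_prob \<mu> \<longleftrightarrow> prob_space \<mu> \<and> sets \<mu> = sets borel"

definition cauchy_tr :: "real measure \<Rightarrow> complex \<Rightarrow> complex" where
  "cauchy_tr \<mu> z = integral\<^sup>L \<mu> (\<lambda>x. 1 / (z - complex_of_real x))"

definition H_tr :: "real measure \<Rightarrow> complex \<Rightarrow> complex" where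
  "H_tr \<mu> z = 1 / cauchy_tr \<mu> z"

definition is_mconv :: "real measure \<Rightarrow> real measure \<Rightarrow> real measure \<Rightarrow> bool" where
  "is_mconv \<mu> \<nu> \<rho> \<longleftrightarrow> real_prob \<rho> \<and>
     (\<forall>z. Im z > 0 \<longrightarrow> H_tr \<rho> z = H_tr \<mu> (H_tr \<nu> z))"

definition mconv :: "real measure \<Rightarrow> real measure \<Rightarrow> real measure" where
  "mconv \<mu> \<nu> = (THE \<rho>. is_mconv \<mu> \<nu> \<rho>)"

fun mpow :: "real measure \<Rightarrow> nat \<Rightarrow> real measure" where
  "mpow \<mu> 0 = return borel 0"
| "mpow \<mu> (Suc N) = mconv \<mu> (mpow \<mu> N)"

definition mcumulant :: "real measure \<Rightarrow> nat \<Rightarrow> real" where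
  "mcumulant \<mu> n = (THE c. \<exists>p :: real poly.
      (\<forall>N\<ge>1. poly p (real N) = moment (mpow \<mu> N) n) \<and> coeff p 1 = c)"

definition noncrossing :: "nat set set \<Rightarrow> bool" where
  "noncrossing \<pi> \<longleftrightarrow> \<not> (\<exists>V\<in>\<pi>. \<exists>W\<in>\<pi>. V \<noteq> W \<and>
      (\<exists>a b c d. a < b \<and> b < c \<and> c < d \<and> a \<in> V \<and> c \<in> V \<and> b \<in> W \<and> d \<in> W))"

definition inner_side :: "nat set \<Rightarrow> nat set \<Rightarrow> bool" where
  "inner_side V W \<longleftrightarrow> (\<exists>w1\<in>W. \<exists>w2\<in>W. \<forall>v\<in>V. w1 < v \<and> v < w2)"

text \<open>A linear order on the blocks is encoded as a list enumerating the blocks in increasing order.\<close>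
definition monotone_partitions :: "nat \<Rightarrow> (nat set set \<times> nat set list) set" where
  "monotone_partitions n = {(\<pi>, xs). partition_on {1..n} \<pi> \<and> noncrossing \<pi> \<and>
      distinct xs \<and> set xs = \<pi> \<and>
      (\<forall>i<length xs. \<forall>j<length xs. inner_side (xs ! i) (xs ! j) \<longrightarrow> j < i)}"

end

(*
  Let g(w) = w + m_1 w^2 + m_2 w^3 + ..., so that the Cauchy transform of mu is g(1/z) asymptotically.
  Monotone convolution composes these series, hence the N-th power has series g^(N), the N-fold
  composite, whose coefficients P_n(N) are polynomials in N with linear coefficient r_n. Differentiating
  g^(t+s) = g^(t) o g^(s) in s at s = 0 gives P_n' = sum_{k<n} (k + 1) r_(n-k) P_k. On the other side, the
  last block of a monotone partition of {1..n} is an interval, and an interval of size n - k can be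
  inserted into {1..k} in k + 1 ways; so sum_(pi, lambda) r(pi) t^|pi| / |pi|! solves the same equations,
  and t = 1 gives the theorem.

  That the convolution is well defined needs Stieltjes inversion for uniqueness, and for existence an
  approximation by finitely supported measures (where it is a partial fraction decomposition) together
  with Helly's selection theorem. Finiteness of its moments is Hamburger's theorem.
*)
theory Submission
  imports Defs
    "HOL-Computational_Algebra.Fundamental_Theorem_Algebra"
    "HOL-Computational_Algebra.Formal_Power_Series"
begin

section \<open>Cauchy transforms and Stieltjes inversion\<close>

text \<open>The limit measure supplied by Helly's theorem carries no information on its moments, so
  these must be recovered from its transform alone. An expansion along the imaginary axis is enough,
  and substituting one such expansion into another is formal composition of series. The outer
  transform is evaluated at \<open>H_tr \<nu> z\<close>, which is safe because \<open>H_tr\<close>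
  never lowers imaginary parts. Existence reduces to a point mass on the left: for fixed w,
  \<open>cauchy_tr \<mu> w\<close> is an average of \<open>1 / (w - x)\<close>, so the convolution
  is a mixture over x of the convolutions of point masses with the right factor. Iterates with real
  exponent never occur: an identity in t is an identity of polynomials, checked at natural
  exponents. On the analytic side the factor k + 1 is Leibniz' rule: since g^(0) = w, the derivative
  of (g^(s))^(k+1) at s = 0 is (k + 1) w^k times the derivative of g^(s).\<close>

lemma real_prob_iff: "real_prob \<mu> \<longleftrightarrow> real_distribution \<mu>"
  by (auto simp: real_prob_def real_distribution_def real_distribution_axioms_def)

lemma (in real_distribution) measure_UNIV [simp]: "measure M UNIV = 1"
  using prob_space by simp

lemma abs_arctan_le: "\<bar>arctan x\<bar> \<le> pi / 2"
  using arctan_lbound[of x] arctan_ubound[of x] by (simp add: abs_le_iff)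

lemma resolvent_nz: "Im z > 0 \<Longrightarrow> z - complex_of_real x \<noteq> 0"
  by (metis Im_complex_of_real diff_0_right eq_iff_diff_eq_0 minus_complex.simps(2) order_less_irrefl)

lemma norm_resolvent_le:
  assumes "Im z > 0"
  shows "norm (1 / (z - complex_of_real x)) \<le> 1 / Im z"
proof -
  have "Im z \<le> norm (z - complex_of_real x)"
    using abs_Im_le_cmod[of "z - complex_of_real x"] by simp
  then show ?thesis
    using assms by (simp add: norm_divide frac_le)
qed

lemma Im_resolvent: "Im (1 / (z - complex_of_real x)) = - Im z / (norm (z - complex_of_real x))\<^sup>2"
  by (simp add: Im_divide cmod_power2)

lemma integrable_resolvent:
  assumes "real_prob \<mu>" "Im z > 0"
  shows "integrable \<mu> (\<lambda>x. 1 / (z - complex_of_real x))"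
proof -
  interpret real_distribution \<mu> using assms by (simp add: real_prob_iff)
  show ?thesis
    by (rule integrable_const_bound[where B = "1 / Im z"])
      (use norm_resolvent_le[OF assms(2)] in auto)
qed

lemma norm_cauchy_tr_le:
  assumes "real_prob \<mu>" "Im z > 0"
  shows "norm (cauchy_tr \<mu> z) \<le> 1 / Im z"
proof -
  interpret real_distribution \<mu> using assms by (simp add: real_prob_iff)
  have "norm (cauchy_tr \<mu> z) \<le> (\<integral>x. norm (1 / (z - complex_of_real x)) \<partial>\<mu>)"
    unfolding cauchy_tr_def by (rule integral_norm_bound)
  also have "\<dots> \<le> (\<integral>x. 1 / Im z \<partial>\<mu>)"
    by (intro integral_mono integrable_norm integrable_resolvent assms norm_resolvent_le) auto
  finally show ?thesis by simp
qed

text \<open>Jensen's inequality \<open>|G|\<^sup>2 \<le> \<integral> |z - x|\<^sup>-\<^sup>2\<close> makes \<open>H_tr \<mu>\<close> increase imaginary parts.\<close>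

lemma Im_cauchy_tr_le:
  assumes "real_prob \<mu>" "Im z > 0"
  shows "(norm (cauchy_tr \<mu> z))\<^sup>2 * Im z \<le> - Im (cauchy_tr \<mu> z)"
proof -
  interpret real_distribution \<mu> using assms by (simp add: real_prob_iff)
  define f where "f x = norm (1 / (z - complex_of_real x))" for x
  have f_bound: "f x \<le> 1 / Im z" "0 \<le> f x" for x
    using norm_resolvent_le[OF assms(2)] by (auto simp: f_def)
  have int: "integrable \<mu> f"
    unfolding f_def by (intro integrable_norm integrable_resolvent assms)
  have int2: "integrable \<mu> (\<lambda>x. (f x)\<^sup>2)"
  proof (rule integrable_const_bound[where B = "(1 / Im z)\<^sup>2"])
    show "AE x in \<mu>. norm ((f x)\<^sup>2) \<le> (1 / Im z)\<^sup>2"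
      using f_bound by (auto intro!: power_mono simp del: power_divide)
  qed (use int in measurable)
  define c where "c = (\<integral>x. f x \<partial>\<mu>)"
  have "0 \<le> (\<integral>x. (f x - c)\<^sup>2 \<partial>\<mu>)" by (intro integral_nonneg_AE) auto
  also have "\<dots> = (\<integral>x. (f x)\<^sup>2 - 2 * c * f x + c\<^sup>2 \<partial>\<mu>)"
    by (simp add: power2_diff algebra_simps)
  also have "\<dots> = (\<integral>x. (f x)\<^sup>2 \<partial>\<mu>) - c\<^sup>2"
    using int int2 by (simp add: c_def[symmetric] power2_eq_square)
  finally have "c\<^sup>2 \<le> (\<integral>x. (f x)\<^sup>2 \<partial>\<mu>)" by simp
  moreover have "norm (cauchy_tr \<mu> z) \<le> c"
    unfolding cauchy_tr_def c_def f_def by (rule integral_norm_bound)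
  ultimately have "(norm (cauchy_tr \<mu> z))\<^sup>2 \<le> (\<integral>x. (f x)\<^sup>2 \<partial>\<mu>)"
    by (meson norm_ge_zero order_trans power_mono)
  moreover have "Im (cauchy_tr \<mu> z) = (\<integral>x. - Im z * (f x)\<^sup>2 \<partial>\<mu>)"
    unfolding cauchy_tr_def
    by (subst integral_Im[symmetric, OF integrable_resolvent[OF assms]])
      (simp add: Im_resolvent f_def norm_divide power_divide)
  ultimately show ?thesis using assms(2) by (simp add: mult.commute)
qed

text \<open>The integrand has strictly negative imaginary part everywhere, so the integral could
  vanish only for the zero measure. Strictness keeps \<open>H_tr\<close> a true reciprocal.\<close>

lemma Im_cauchy_tr_neg:
  assumes "real_prob \<mu>" "Im z > 0"
  shows "Im (cauchy_tr \<mu> z) < 0"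
proof -
  interpret real_distribution \<mu> using assms by (simp add: real_prob_iff)
  have "Im (cauchy_tr \<mu> z) = (\<integral>x. Im (1 / (z - complex_of_real x)) \<partial>\<mu>)"
    unfolding cauchy_tr_def by (rule integral_Im[symmetric, OF integrable_resolvent[OF assms]])
  moreover have "0 < (\<integral>x. - Im (1 / (z - complex_of_real x)) \<partial>\<mu>)"
  proof -
    have int: "integrable \<mu> (\<lambda>x. - Im (1 / (z - complex_of_real x)))"
      by (intro integrable_minus integrable_Im integrable_resolvent assms)
    have pos: "- Im (1 / (z - complex_of_real x)) > 0" for x
      using assms(2) resolvent_nz[OF assms(2), of x] by (simp add: Im_resolvent)
    have "0 \<le> (\<integral>x. - Im (1 / (z - complex_of_real x)) \<partial>\<mu>)"
      using pos by (intro integral_nonneg_AE) (auto intro: less_imp_le)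
    moreover have "(\<integral>x. - Im (1 / (z - complex_of_real x)) \<partial>\<mu>) \<noteq> 0"
    proof
      assume "(\<integral>x. - Im (1 / (z - complex_of_real x)) \<partial>\<mu>) = 0"
      then have "AE x in \<mu>. - Im (1 / (z - complex_of_real x)) = 0"
        using integral_nonneg_eq_0_iff_AE[OF int] pos by (auto intro: less_imp_le)
      then have "AE x in \<mu>. False" by eventually_elim (use pos in \<open>metis less_irrefl\<close>)
      then show False by (metis AE_False prob_space zero_neq_one emeasure_space_1)
    qed
    ultimately show ?thesis by linarith
  qed
  ultimately show ?thesis by simp
qed

lemma cauchy_tr_nz: "real_prob \<mu> \<Longrightarrow> Im z > 0 \<Longrightarrow> cauchy_tr \<mu> z \<noteq> 0"
  using Im_cauchy_tr_neg by fastforce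

lemma Im_H_tr_ge:
  assumes "real_prob \<mu>" "Im z > 0"
  shows "Im z \<le> Im (H_tr \<mu> z)"
proof -
  have "Im (H_tr \<mu> z) = (- Im (cauchy_tr \<mu> z)) / (norm (cauchy_tr \<mu> z))\<^sup>2"
    by (simp add: H_tr_def Im_divide cmod_power2)
  moreover have "Im z \<le> (- Im (cauchy_tr \<mu> z)) / (norm (cauchy_tr \<mu> z))\<^sup>2"
    using Im_cauchy_tr_le[OF assms] cauchy_tr_nz[OF assms]
    by (subst pos_le_divide_eq) (auto simp: mult.commute)
  ultimately show ?thesis by simp
qed

lemma abs_arctan_diff_le: "\<bar>arctan a - arctan b\<bar> \<le> \<bar>a - b\<bar>"
proof -
  have "norm (arctan a - arctan b) \<le> 1 * norm (a - b)"
  proof (rule field_differentiable_bound[of UNIV arctan "\<lambda>x. inverse (1 + x\<^sup>2)"])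
    show "norm (inverse (1 + x\<^sup>2)) \<le> 1" for x :: real
      by (simp add: inverse_le_1_iff)
  qed (auto intro!: DERIV_arctan)
  then show ?thesis by simp
qed

text \<open>\<open>\<integral> arctan ((s - x) / e) d\<rho>\<close> is, up to sign, an antiderivative of the Poisson integral of \<open>\<rho>\<close>;
  using it replaces Fubini's theorem in the Stieltjes inversion.\<close>

lemma DERIV_arctan_integral:
  assumes "real_prob \<rho>" "e > 0"
  shows "((\<lambda>s. \<integral>x. arctan ((s - x) / e) \<partial>\<rho>) has_real_derivative - Im (cauchy_tr \<rho> (Complex s e))) (at s)"
proof -
  interpret real_distribution \<rho> using assms by (simp add: real_prob_iff)
  have int: "integrable \<rho> (\<lambda>x. arctan ((s - x) / e))" for s
  proof (rule integrable_const_bound[where B = "pi / 2"])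
    show "AE x in \<rho>. norm (arctan ((s - x) / e)) \<le> pi / 2"
      by (intro AE_I2) (simp only: real_norm_def abs_arctan_le)
  qed auto
  have G: "- Im (cauchy_tr \<rho> (Complex s e)) = (\<integral>x. e / ((s - x)\<^sup>2 + e\<^sup>2) \<partial>\<rho>)"
  proof -
    have "Im (cauchy_tr \<rho> (Complex s e)) = (\<integral>x. Im (1 / (Complex s e - complex_of_real x)) \<partial>\<rho>)"
      unfolding cauchy_tr_def
      by (rule integral_Im[symmetric, OF integrable_resolvent[OF assms(1)]]) (use assms in auto)
    also have "\<dots> = (\<integral>x. - (e / ((s - x)\<^sup>2 + e\<^sup>2)) \<partial>\<rho>)"
      by (intro Bochner_Integration.integral_cong) (auto simp: Im_resolvent cmod_power2)
    finally show ?thesis by simp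
  qed
  have pw: "((\<lambda>h. (arctan ((s + h - x) / e) - arctan ((s - x) / e)) / h) \<longlongrightarrow> e / ((s - x)\<^sup>2 + e\<^sup>2)) (at 0)"
    for x
  proof -
    have "((\<lambda>s. arctan ((s - x) / e)) has_real_derivative (1 / e) * inverse (1 + ((s - x) / e)\<^sup>2)) (at s)"
      using assms(2) by (auto intro!: derivative_eq_intros)
    moreover have "(1 / e) * inverse (1 + ((s - x) / e)\<^sup>2) = e / ((s - x)\<^sup>2 + e\<^sup>2)"
      using assms(2) by (simp add: field_simps power2_eq_square)
    ultimately show ?thesis by (simp add: DERIV_def)
  qed
  show ?thesis
    unfolding DERIV_def G tendsto_at_iff_sequentially
  proof safe
    fix X :: "nat \<Rightarrow> real"
    assume X: "\<forall>i. X i \<in> UNIV - {0}" "X \<longlonglongrightarrow> 0"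
    have "(\<lambda>i. \<integral>x. (arctan ((s + X i - x) / e) - arctan ((s - x) / e)) / X i \<partial>\<rho>)
        \<longlonglongrightarrow> (\<integral>x. e / ((s - x)\<^sup>2 + e\<^sup>2) \<partial>\<rho>)"
    \<comment> \<open>The dominating constant is the Lipschitz constant of
      \<open>arctan (x / e)\<close>.\<close>
    proof (rule integral_dominated_convergence[where w = "\<lambda>_. 1 / e"])
      show "AE x in \<rho>. (\<lambda>i. (arctan ((s + X i - x) / e) - arctan ((s - x) / e)) / X i)
          \<longlonglongrightarrow> e / ((s - x)\<^sup>2 + e\<^sup>2)"
      proof (rule AE_I2)
        fix x
        show "(\<lambda>i. (arctan ((s + X i - x) / e) - arctan ((s - x) / e)) / X i)
          \<longlonglongrightarrow> e / ((s - x)\<^sup>2 + e\<^sup>2)"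
          using pw[of x, unfolded tendsto_at_iff_sequentially, rule_format, of X] X by (simp add: o_def)
      qed
      show "AE x in \<rho>. norm ((arctan ((s + X i - x) / e) - arctan ((s - x) / e)) / X i) \<le> 1 / e" for i
      proof (rule AE_I2)
        fix x
        have "\<bar>arctan ((s + X i - x) / e) - arctan ((s - x) / e)\<bar> \<le> \<bar>(s + X i - x) / e - (s - x) / e\<bar>"
          by (rule abs_arctan_diff_le)
        also have "\<dots> = \<bar>X i\<bar> / e" using assms(2) by (simp flip: diff_divide_distrib)
        finally show "norm ((arctan ((s + X i - x) / e) - arctan ((s - x) / e)) / X i) \<le> 1 / e"
          using X(1)[rule_format, of i] assms(2) by (simp add: field_simps)
      qed
    qed auto
    moreover have "(\<integral>x. (arctan ((s + X i - x) / e) - arctan ((s - x) / e)) / X i \<partial>\<rho>) =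
        ((\<integral>x. arctan ((s + X i - x) / e) \<partial>\<rho>) - (\<integral>x. arctan ((s - x) / e) \<partial>\<rho>)) / X i" for i
      by (simp only: integral_divide_zero Bochner_Integration.integral_diff[OF int int])
    ultimately show "((\<lambda>h. ((\<integral>x. arctan ((s + h - x) / e) \<partial>\<rho>) - (\<integral>x. arctan ((s - x) / e) \<partial>\<rho>)) / h) \<circ> X)
      \<longlonglongrightarrow> (\<integral>x. e / ((s - x)\<^sup>2 + e\<^sup>2) \<partial>\<rho>)"
      by (simp only: o_def)
  qed
qed

text \<open>Fixes the constant of integration: antiderivatives of the same Poisson integral that
  agree at minus infinity agree everywhere.\<close>

lemma arctan_integral_at_bot:
  assumes "real_prob \<rho>" "e > 0"
  shows "(\<lambda>n. \<integral>x. arctan ((- real n - x) / e) \<partial>\<rho>) \<longlonglongrightarrow> - (pi / 2)"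
proof -
  interpret real_distribution \<rho> using assms by (simp add: real_prob_iff)
  have "(\<lambda>n. \<integral>x. arctan ((- real n - x) / e) \<partial>\<rho>) \<longlonglongrightarrow> (\<integral>x. - (pi / 2) \<partial>\<rho>)"
  proof (rule integral_dominated_convergence[where w = "\<lambda>_. pi / 2"])
    show "AE x in \<rho>. (\<lambda>i. arctan ((- real i - x) / e)) \<longlonglongrightarrow> - (pi / 2)"
    proof (rule AE_I2)
      fix x
      have "filterlim (\<lambda>i. (- real i - x) / e) at_bot sequentially"
        using assms(2) by real_asymp
      then show "(\<lambda>i. arctan ((- real i - x) / e)) \<longlonglongrightarrow> - (pi / 2)"
        by (rule filterlim_compose[OF tendsto_arctan_at_bot])
    qed
    show "AE x in \<rho>. norm (arctan ((- real i - x) / e)) \<le> pi / 2" for i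
      by (rule AE_I2) (simp only: real_norm_def abs_arctan_le)
  qed auto
  then show ?thesis by (simp add: prob_space)
qed

text \<open>As the scale tends to 0 the kernel becomes pi/2 times the sign function. Its value 0 at
  the jump counts an atom at s by half, so the limit sees the mean of the cdf and its left
  limit.\<close>

lemma arctan_integral_eps:
  assumes "real_prob \<rho>"
  shows "(\<lambda>n. \<integral>x. arctan ((s - x) / (1 / real (Suc n))) \<partial>\<rho>)
    \<longlonglongrightarrow> pi / 2 * (measure \<rho> {..s} + measure \<rho> {..<s} - 1)"
proof -
  interpret real_distribution \<rho> using assms by (simp add: real_prob_iff)
  have "(\<lambda>n. \<integral>x. arctan ((s - x) / (1 / real (Suc n))) \<partial>\<rho>) \<longlonglongrightarrow> (\<integral>x. pi / 2 * sgn (s - x) \<partial>\<rho>)"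
  proof (rule integral_dominated_convergence[where w = "\<lambda>_. pi / 2"])
    show "AE x in \<rho>. (\<lambda>i. arctan ((s - x) / (1 / real (Suc i)))) \<longlonglongrightarrow> pi / 2 * sgn (s - x)"
    proof (rule AE_I2)
      fix x
      consider "s < x" | "s = x" | "x < s" by linarith
      then show "(\<lambda>i. arctan ((s - x) / (1 / real (Suc i)))) \<longlonglongrightarrow> pi / 2 * sgn (s - x)"
      proof cases
        case 1
        have "filterlim (\<lambda>i. (s - x) / (1 / real (Suc i))) at_bot sequentially"
          using 1 by real_asymp
        then show ?thesis
          using 1 filterlim_compose[OF tendsto_arctan_at_bot] by simp
      next
        case 3
        have "filterlim (\<lambda>i. (s - x) / (1 / real (Suc i))) at_top sequentially"
          using 3 by real_asymp
        then show ?thesis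
          using 3 filterlim_compose[OF tendsto_arctan_at_top] by simp
      qed simp
    qed
    show "AE x in \<rho>. norm (arctan ((s - x) / (1 / real (Suc i)))) \<le> pi / 2" for i
      by (intro AE_I2) (simp only: real_norm_def abs_arctan_le)
  qed auto
  also have "(\<integral>x. pi / 2 * sgn (s - x) \<partial>\<rho>)
      = (\<integral>x. pi / 2 * (indicator {..s} x + indicator {..<s} x - 1) \<partial>\<rho>)"
    by (intro Bochner_Integration.integral_cong) (auto simp: indicator_def sgn_if)
  also have "\<dots> = pi / 2 * (measure \<rho> {..s} + measure \<rho> {..<s} - 1)"
    by (simp add: prob_space less_top[symmetric] emeasure_eq_measure)
  finally show ?thesis .
qed

theorem cauchy_tr_unique:
  assumes \<rho>: "real_prob \<rho>" and \<sigma>: "real_prob \<sigma>"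
    and eq: "\<And>z. Im z > 0 \<Longrightarrow> cauchy_tr \<rho> z = cauchy_tr \<sigma> z"
  shows "\<rho> = \<sigma>"
proof -
  interpret \<rho>: real_distribution \<rho> using \<rho> by (simp add: real_prob_iff)
  interpret \<sigma>: real_distribution \<sigma> using \<sigma> by (simp add: real_prob_iff)
  have arc: "(\<integral>x. arctan ((s - x) / e) \<partial>\<rho>) = (\<integral>x. arctan ((s - x) / e) \<partial>\<sigma>)" if e: "e > 0" for s e
  proof -
    define D where "D s = (\<integral>x. arctan ((s - x) / e) \<partial>\<rho>) - (\<integral>x. arctan ((s - x) / e) \<partial>\<sigma>)" for s
    have "(D has_real_derivative 0) (at s)" for s
      using DERIV_diff[OF DERIV_arctan_integral[OF \<rho> e, of s] DERIV_arctan_integral[OF \<sigma> e, of s]] e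
      by (simp add: D_def[abs_def] eq)
    then have const: "D s = D t" for s t by (metis DERIV_isconst_all)
    have "(\<lambda>n. D (- real n)) \<longlonglongrightarrow> - (pi / 2) - - (pi / 2)"
      unfolding D_def by (intro tendsto_diff arctan_integral_at_bot \<rho> \<sigma> e)
    moreover have "(\<lambda>n. D (- real n)) = (\<lambda>n. D s)" using const by blast
    ultimately have "(\<lambda>n. D s) \<longlonglongrightarrow> 0" by simp
    then have "D s = 0" by (simp add: LIMSEQ_const_iff)
    then show ?thesis by (simp add: D_def)
  qed
  have K: "measure \<rho> {..s} + measure \<rho> {..<s} = measure \<sigma> {..s} + measure \<sigma> {..<s}" for s
  proof -
    have "(\<lambda>n. \<integral>x. arctan ((s - x) / (1 / real (Suc n))) \<partial>\<rho>)
      = (\<lambda>n. \<integral>x. arctan ((s - x) / (1 / real (Suc n))) \<partial>\<sigma>)"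
      by (intro ext arc) simp
    then show ?thesis
      using LIMSEQ_unique[OF arctan_integral_eps[OF \<rho>, of s]] arctan_integral_eps[OF \<sigma>, of s]
      by fastforce
  qed
  \<comment> \<open>At a point t > s both \<open>{..<t}\<close> and \<open>{..t}\<close> contain
    \<open>{..s}\<close>, so the half-counted atom does no harm; right continuity then lets t
    decrease to s. The claim is stated for arbitrary measures in order to be used in both
    directions.\<close>
  have cdf_le: "cdf \<alpha> s \<le> cdf \<beta> s" 
    if \<alpha>: "real_distribution \<alpha>" and \<beta>: "real_distribution \<beta>" and
      K: "\<And>s. measure \<alpha> {..s} + measure \<alpha> {..<s} = measure \<beta> {..s} + measure \<beta> {..<s}" for \<alpha> \<beta> s
  proof -
    interpret \<alpha>: real_distribution \<alpha> by fact
    interpret \<beta>: real_distribution \<beta> by fact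
    have "2 * cdf \<alpha> s \<le> 2 * cdf \<beta> (s + inverse (real (Suc n)))" for n
    proof -
      let ?t = "s + inverse (real (Suc n))"
      have "s < ?t" by simp
      then have "cdf \<alpha> s \<le> measure \<alpha> {..<?t}" "cdf \<alpha> s \<le> measure \<alpha> {..?t}"
        unfolding cdf_def by (auto intro!: \<alpha>.finite_measure_mono elim: order.strict_trans1)
      moreover have "measure \<beta> {..<?t} \<le> measure \<beta> {..?t}"
        by (auto intro!: \<beta>.finite_measure_mono)
      ultimately show ?thesis using K[of ?t] by (simp add: cdf_def)
    qed
    moreover have "(\<lambda>n. 2 * cdf \<beta> (s + inverse (real (Suc n)))) \<longlonglongrightarrow> 2 * cdf \<beta> s"
    proof (intro tendsto_mult_left)
      have "(cdf \<beta> \<longlongrightarrow> cdf \<beta> s) (at_right s)"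
        using \<beta>.cdf_is_right_cont[of s] by (simp add: continuous_within)
      moreover have "filterlim (\<lambda>n. s + inverse (real (Suc n))) (at_right s) sequentially"
      proof (rule tendsto_imp_filterlim_at_right)
        have "(\<lambda>n. s + inverse (real (Suc n))) \<longlonglongrightarrow> s + 0"
          by (intro tendsto_add tendsto_const LIMSEQ_inverse_real_of_nat)
        then show "(\<lambda>n. s + inverse (real (Suc n))) \<longlonglongrightarrow> s" by simp
      qed auto
      ultimately show "(\<lambda>n. cdf \<beta> (s + inverse (real (Suc n)))) \<longlonglongrightarrow> cdf \<beta> s"
        by (rule filterlim_compose)
    qed
    ultimately have "2 * cdf \<alpha> s \<le> 2 * cdf \<beta> s"
      by (intro LIMSEQ_le_const[of _ "2 * cdf \<beta> s"] exI[of _ 0]) blast+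
    then show ?thesis by simp
  qed
  show ?thesis
  proof (rule cdf_unique)
    show "cdf \<rho> = cdf \<sigma>"
      using cdf_le[of \<rho> \<sigma>] cdf_le[of \<sigma> \<rho>] K \<rho>.real_distribution_axioms \<sigma>.real_distribution_axioms
      by (intro ext antisym) auto
  qed unfold_locales
qed

section \<open>Existence of the monotone convolution\<close>

text \<open>A pushforward from the index set, so that the locations \<open>x i\<close> may coincide;
  this happens when convolutions with different point masses are mixed.\<close>

lemma finite_support_cauchy_tr:
  assumes "finite I" "\<And>i. i \<in> I \<Longrightarrow> 0 \<le> p i" "(\<Sum>i\<in>I. p i) = 1"
  obtains \<rho> where "real_prob \<rho>"
    "\<And>z. Im z > 0 \<Longrightarrow> cauchy_tr \<rho> z = (\<Sum>i\<in>I. of_real (p i) / (z - of_real (x i)))"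
proof
  let ?\<rho> = "distr (point_measure I p) borel x"
  have [measurable]: "x \<in> measurable (point_measure I p) borel"
    by (simp add: measurable_point_measure_eq1)
  have "prob_space (point_measure I p)"
  proof (rule prob_spaceI)
    show "emeasure (point_measure I p) (space (point_measure I p)) = 1"
      using assms by (simp add: space_point_measure emeasure_point_measure_finite sum_ennreal)
  qed
  then show "real_prob ?\<rho>"
    by (auto simp: real_prob_def intro: prob_space.prob_space_distr)
  show "cauchy_tr ?\<rho> z = (\<Sum>i\<in>I. of_real (p i) / (z - of_real (x i)))" if "Im z > 0" for z
    unfolding cauchy_tr_def
    by (subst integral_distr)
      (use assms in \<open>auto simp: lebesgue_integral_point_measure_finite scaleR_conv_of_real\<close>)
qed

lemma cauchy_tr_distr:
  assumes "real_prob \<mu>" "f \<in> borel_measurable borel"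
  shows "cauchy_tr (distr \<mu> borel f) z = (\<integral>x. 1 / (z - complex_of_real (f x)) \<partial>\<mu>)"
proof -
  interpret real_distribution \<mu> using assms by (simp add: real_prob_iff)
  show ?thesis
    unfolding cauchy_tr_def using assms(2) by (subst integral_distr) auto
qed

lemma integral_finite_range:
  fixes h :: "real \<Rightarrow> complex"
  assumes "real_prob \<mu>" and [measurable]: "f \<in> borel_measurable borel" and fin: "finite (range f)"
  shows "(\<integral>x. h (f x) \<partial>\<mu>) = (\<Sum>v\<in>range f. of_real (measure \<mu> (f -` {v})) * h v)"
    and "(\<Sum>v\<in>range f. measure \<mu> (f -` {v})) = 1"
proof -
  interpret real_distribution \<mu> using assms by (simp add: real_prob_iff)
  have [measurable]: "f -` {v} \<in> sets borel" for v
    using measurable_sets[OF assms(2), of "{v}"] by simp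
  have *: "(\<Sum>v\<in>range f. indicator (f -` {v}) x *\<^sub>R k v) = k (f x)" for x and k :: "real \<Rightarrow> 'a::real_vector"
  proof -
    have "(\<Sum>v\<in>range f. indicator (f -` {v}) x *\<^sub>R k v) = (\<Sum>v\<in>range f. if v = f x then k v else 0)"
      by (intro sum.cong) (auto simp: indicator_def)
    then show ?thesis using fin by simp
  qed
  have int: "(\<integral>x. k (f x) \<partial>\<mu>) = (\<Sum>v\<in>range f. measure \<mu> (f -` {v}) *\<^sub>R k v)"
    for k :: "real \<Rightarrow> 'b::{banach, second_countable_topology}"
  proof -
    have "(\<integral>x. k (f x) \<partial>\<mu>) = (\<integral>x. (\<Sum>v\<in>range f. indicator (f -` {v}) x *\<^sub>R k v) \<partial>\<mu>)"
      by (simp only: *)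
    also have "\<dots> = (\<Sum>v\<in>range f. \<integral>x. indicator (f -` {v}) x *\<^sub>R k v \<partial>\<mu>)"
      by (rule Bochner_Integration.integral_sum) (simp add: emeasure_eq_measure)
    finally show ?thesis by (simp add: emeasure_eq_measure)
  qed
  show "(\<integral>x. h (f x) \<partial>\<mu>) = (\<Sum>v\<in>range f. of_real (measure \<mu> (f -` {v})) * h v)"
    unfolding int by (simp add: scaleR_conv_of_real)
  show "(\<Sum>v\<in>range f. measure \<mu> (f -` {v})) = 1"
    using int[of "\<lambda>_. 1::real"] by simp
qed

section \<open>Partial fractions with simple poles\<close>

definition root_prod :: "complex set \<Rightarrow> complex poly" where
  "root_prod S = (\<Prod>s\<in>S. [:-s, 1:])"

text \<open>The numerator of the partial fraction sum of \<open>c s / (z - s)\<close> over the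
  common denominator \<open>root_prod S\<close>.\<close>

definition residue_sum :: "complex set \<Rightarrow> (complex \<Rightarrow> complex) \<Rightarrow> complex poly" where
  "residue_sum S c = (\<Sum>s\<in>S. smult (c s) (root_prod (S - {s})))"

lemma degree_root_prod: "degree (root_prod S) = card S"
  unfolding root_prod_def by (subst degree_prod_sum_eq) auto

lemma coeff_root_prod: "poly.coeff (root_prod S) (card S) = 1"
  using lead_coeff_prod[of "\<lambda>s. [:-s, 1:]" S] degree_root_prod[of S] by (simp add: root_prod_def)

lemma poly_root_prod: "poly (root_prod S) z = (\<Prod>s\<in>S. z - s)"
  by (simp add: root_prod_def poly_prod)

text \<open>Makes the total mass visible in the numerator: equal numerators over denominators of
  equal degree have equal sums of residues, so the new weights again sum to 1.\<close>

lemma coeff_residue_sum: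
  assumes "finite S"
  shows "poly.coeff (residue_sum S c) (card S - 1) = (\<Sum>s\<in>S. c s)"
proof -
  have "poly.coeff (root_prod (S - {s})) (card S - 1) = 1" if "s \<in> S" for s
    using coeff_root_prod[of "S - {s}"] assms that by simp
  then show ?thesis by (simp add: residue_sum_def coeff_sum)
qed

lemma degree_residue_sum:
  assumes "finite S" "S \<noteq> {}"
  shows "degree (residue_sum S c) < card S"
proof -
  have "degree (residue_sum S c) \<le> card S - 1"
    unfolding residue_sum_def
  proof (intro degree_sum_le)
    fix s assume "s \<in> S"
    then have "degree (root_prod (S - {s})) = card S - 1"
      using assms by (simp add: degree_root_prod)
    then show "degree (smult (c s) (root_prod (S - {s}))) \<le> card S - 1"
      by (metis degree_smult_le)
  qed (use assms in auto)
  moreover have "card S > 0" using assms by (simp add: card_gt_0_iff)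
  ultimately show ?thesis by linarith
qed

lemma poly_residue_sum:
  assumes "finite S" "z \<notin> S"
  shows "poly (residue_sum S c) z = poly (root_prod S) z * (\<Sum>s\<in>S. c s / (z - s))"
proof -
  have "poly (root_prod (S - {s})) z = poly (root_prod S) z / (z - s)" if "s \<in> S" for s
    using prod.remove[OF assms(1) that, of "\<lambda>s. z - s"] assms(2) that by (auto simp: poly_root_prod)
  then show ?thesis by (simp add: residue_sum_def poly_sum sum_distrib_left mult.commute)
qed

lemma poly_residue_sum_root:
  assumes "finite S" "s \<in> S"
  shows "poly (residue_sum S c) s = c s * poly (root_prod (S - {s})) s"
proof -
  have "poly (root_prod (S - {t})) s = 0" if "t \<noteq> s" for t
    using assms that by (auto simp: poly_root_prod)
  then have "poly (residue_sum S c) s = (\<Sum>t\<in>S. if t = s then c t * poly (root_prod (S - {t})) t else 0)"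
    unfolding residue_sum_def poly_sum by (intro sum.cong) auto
  then show ?thesis using assms by simp
qed

lemma pderiv_root_prod:
  assumes "finite S" "s \<in> S"
  shows "poly (pderiv (root_prod S)) s = poly (root_prod (S - {s})) s"
proof -
  have "root_prod S = [:-s, 1:] * root_prod (S - {s})"
    unfolding root_prod_def by (rule prod.remove[OF assms])
  then show ?thesis
    by (simp only: pderiv_mult poly_add poly_mult) (simp add: pderiv_pCons)
qed

text \<open>The transform of \<open>\<delta>\<^sub>x \<rhd> \<nu>\<close> is \<open>G / (1 - x G)\<close> with \<open>G\<close> the transform of \<open>\<nu>\<close>. For finitely supported \<open>\<nu>\<close>
  this is rational with denominator \<open>R = Q (1 - x G)\<close>, \<open>Q\<close> having the atoms of \<open>\<nu>\<close> as roots. The roots of \<open>R\<close> are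
  real since \<open>G\<close> is not real off the real line, and simple with positive residue \<open>-1 / (x\<^sup>2 G')\<close>
  since \<open>G' < 0\<close> on the real line.\<close>

lemma finite_support_delta_mconv:
  fixes S :: "real set" and q :: "real \<Rightarrow> real" and x :: real
  assumes S: "finite S" and q: "\<And>s. s \<in> S \<Longrightarrow> 0 < q s" "(\<Sum>s\<in>S. q s) = 1"
  defines "G \<equiv> \<lambda>z. \<Sum>s\<in>S. complex_of_real (q s) / (z - of_real s)"
  shows "\<exists>T w. finite T \<and> (\<forall>t\<in>T. 0 \<le> w t) \<and> (\<Sum>t\<in>T. w t) = (1::real) \<and>
    (\<forall>z. Im z > 0 \<longrightarrow> 1 / (1 / G z - of_real x) = (\<Sum>t\<in>T. complex_of_real (w t) / (z - of_real t)))"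
proof (cases "x = 0")
  \<comment> \<open>The point mass at 0 is the unit of the convolution, and the residues below
    divide by \<open>x\<close>.\<close>
  case True
  then show ?thesis
    using S q by (intro exI[of _ S] exI[of _ q]) (auto simp: G_def less_imp_le)
next
  case x: False
  define A where "A = complex_of_real ` S"
  define c where "c z = complex_of_real (q (Re z))" for z
  have A: "finite A" "A \<noteq> {}" "card A = card S"
    using S q(2) by (auto simp: A_def card_image inj_on_def)
  define P where "P = residue_sum A c"
  define Q where "Q = root_prod A"
  define R where "R = Q - smult (of_real x) P"
  have G_A: "(\<Sum>s\<in>A. c s / (z - s)) = G z" for z
    unfolding A_def G_def by (subst sum.reindex) (auto simp: inj_on_def c_def)
  have P_z: "poly P z = poly Q z * G z" if "z \<notin> A" for z
    using poly_residue_sum[OF A(1) that, of c] by (simp add: P_def Q_def G_A)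
  have Q_z: "poly Q z \<noteq> 0" if "z \<notin> A" for z
    using that A by (auto simp: Q_def poly_root_prod)
  have R_z: "poly R z = poly Q z * (1 - of_real x * G z)" if "z \<notin> A" for z
    using P_z[OF that] by (simp add: R_def algebra_simps)
  \<comment> \<open>At a pole of \<open>G\<close> the polynomial \<open>Q\<close> vanishes but
    \<open>P\<close> does not, as \<open>q\<close> is positive on \<open>S\<close>. Hence no root of
    \<open>R\<close> is a pole, and the formulas with \<open>G\<close> hold at all roots.\<close>
  have R_A: "poly R z \<noteq> 0" if "z \<in> A" for z
  proof -
    have "poly Q z = 0" using that A by (auto simp: Q_def poly_root_prod)
    moreover have "poly P z \<noteq> 0"
      unfolding P_def poly_residue_sum_root[OF A(1) that] using that A q(1)
      by (force simp: poly_root_prod A_def c_def)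
    ultimately show ?thesis using x by (simp add: R_def)
  qed
  have Im_term: "Im (complex_of_real (q s) / (z - of_real s)) = - Im z * (q s / (norm (z - of_real s))\<^sup>2)" for s z
    using Im_resolvent[of z s] by (simp add: Im_divide cmod_power2)
  have Im_G: "Im (G z) \<noteq> 0" if "Im z \<noteq> 0" for z
  proof -
    have "Im (G z) = - Im z * (\<Sum>s\<in>S. q s / (norm (z - of_real s))\<^sup>2)"
      unfolding G_def Im_sum Im_term by (simp add: sum_distrib_left)
    moreover have "(\<Sum>s\<in>S. q s / (norm (z - of_real s))\<^sup>2) > 0"
    proof (rule sum_pos)
      fix s assume "s \<in> S"
      moreover have "z \<noteq> of_real s" using that by auto
      ultimately show "q s / (norm (z - of_real s))\<^sup>2 > 0" using q(1) by simp
    qed (use S A in \<open>auto simp: A_def\<close>)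
    ultimately show ?thesis using that by simp
  qed
  define T where "T = {z. poly R z = 0}"
  have notA: "Im z \<noteq> 0 \<Longrightarrow> z \<notin> A" for z by (auto simp: A_def)
  have T_real: "Im z = 0" if "z \<in> T" for z
  proof (rule ccontr)
    assume im: "Im z \<noteq> 0"
    then have "1 = of_real x * G z"
      using that R_z[OF notA[OF im]] Q_z[OF notA[OF im]] by (simp add: T_def)
    then have "Im 1 = x * Im (G z)" by (metis Im_complex_of_real scaleR_conv_of_real scaleR_complex.simps(2))
    then show False using x Im_G[OF im] by simp
  qed
  have coeff_R: "poly.coeff R (card A) = 1"
  proof -
    have "poly.coeff P (card A) = 0"
      unfolding P_def by (rule coeff_eq_0) (rule degree_residue_sum[OF A(1,2)])
    then show ?thesis using coeff_root_prod[of A] by (simp add: R_def Q_def)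
  qed
  have deg_R: "degree R = card A"
  proof (rule antisym)
    show "degree R \<le> card A"
      unfolding R_def
    proof (rule degree_diff_le)
      show "degree Q \<le> card A" by (simp add: Q_def degree_root_prod)
      show "degree (smult (complex_of_real x) P) \<le> card A"
        using degree_residue_sum[OF A(1,2), of c] degree_smult_le[of "of_real x" P] by (simp add: P_def)
    qed
    show "card A \<le> degree R" by (rule le_degree) (simp add: coeff_R)
  qed
  have R_nz: "R \<noteq> 0" using coeff_R by auto
  have finT: "finite T" unfolding T_def by (rule poly_roots_finite[OF R_nz])
  \<comment> \<open>On real t outside \<open>S\<close> this is minus the derivative of
    \<open>G\<close>.\<close>
  define W where "W t = (\<Sum>s\<in>S. q s / (Re t - s)\<^sup>2)" for t
  have W_pos: "W t > 0" if "t \<in> T" for t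
    unfolding W_def
  proof (rule sum_pos)
    fix s assume s: "s \<in> S"
    have "t \<noteq> of_real s" using that R_A s by (auto simp: T_def A_def)
    then have "Re t \<noteq> s" using T_real[OF that] by (auto simp: complex_eq_iff)
    then show "q s / (Re t - s)\<^sup>2 > 0" using q(1)[OF s] by simp
  qed (use S A in \<open>auto simp: A_def\<close>)
  have T_A: "t \<notin> A" if "t \<in> T" for t using that R_A by (auto simp: T_def)
  have T_G: "G t = 1 / of_real x" if "t \<in> T" for t
    using that R_z[OF T_A[OF that]] Q_z[OF T_A[OF that]] x by (simp add: T_def field_simps)
  \<comment> \<open>In the derivative of \<open>Q * (1 - x * G)\<close> the term with the derivative
    of \<open>Q\<close> carries the factor \<open>1 - x * G t\<close>, which is zero on
    \<open>T\<close>.\<close>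
  have R': "poly (pderiv R) t = poly Q t * (of_real x * of_real (W t))" if t: "t \<in> T" for t
  proof -
    have t_s: "t \<noteq> of_real s" if "s \<in> S" for s using T_A[OF t] that by (auto simp: A_def)
    have "(G has_field_derivative (\<Sum>s\<in>S. - (of_real (q s) / (t - of_real s)\<^sup>2))) (at t)"
      unfolding G_def
    proof (rule DERIV_sum)
      fix s assume "s \<in> S"
      then have "t - of_real s \<noteq> 0" using t_s by simp
      then show "((\<lambda>z. of_real (q s) / (z - of_real s)) has_field_derivative
          - (of_real (q s) / (t - of_real s)\<^sup>2)) (at t)"
        by (auto intro!: derivative_eq_intros simp: power2_eq_square)
    qed
    also have "(\<Sum>s\<in>S. - (of_real (q s) / (t - of_real s)\<^sup>2)) = - of_real (W t)"
    proof -
      have "t = of_real (Re t)" using T_real[OF t] by (simp add: complex_eq_iff)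
      then show ?thesis by (simp add: W_def sum_negf)
    qed
    finally have "((\<lambda>z. poly Q z * (1 - of_real x * G z)) has_field_derivative
        (poly (pderiv Q) t * (1 - of_real x * G t) + (0 - of_real x * (- of_real (W t))) * poly Q t)) (at t)"
      by (intro DERIV_mult poly_DERIV DERIV_diff DERIV_const DERIV_cmult)
    then have "((\<lambda>z. poly Q z * (1 - of_real x * G z)) has_field_derivative
        poly Q t * (of_real x * of_real (W t))) (at t)"
      using x by (simp add: T_G[OF t] mult.commute)
    then have "(poly R has_field_derivative poly Q t * (of_real x * of_real (W t))) (at t)"
      by (rule has_field_derivative_transform_within_open[where S = "- A"])
        (use A T_A[OF t] R_z in \<open>auto intro: finite_imp_closed simp: open_Compl\<close>)
    then show ?thesis using poly_DERIV[of R t] by (metis DERIV_unique)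
  qed
  have "rsquarefree R"
    unfolding rsquarefree_roots
  proof safe
    fix t assume "poly R t = 0" "poly (pderiv R) t = 0"
    then show False
      using R'[of t] W_pos[of t] Q_z[OF T_A[of t]] x by (auto simp: T_def)
  qed
  then have R_T: "R = root_prod T"
    using complex_poly_decompose_rsquarefree[of R] coeff_R deg_R by (simp add: T_def root_prod_def)
  have card_T: "card T = card A" using deg_R degree_root_prod[of T] by (simp add: R_T)
  \<comment> \<open>The residue of \<open>P / R\<close> at t is \<open>P t\<close> over the
    derivative of \<open>R\<close>, that is \<open>(Q t / x) / (Q t * x * W t)\<close>.\<close>
  define w where "w t = 1 / (x\<^sup>2 * W t)" for t
  have P_T: "P = residue_sum T (\<lambda>t. of_real (w t))"
  proof (rule poly_eqI_degree[of T])
    have "T \<noteq> {}" using card_T A by auto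
    then show "card T > degree P" "card T > degree (residue_sum T (\<lambda>t. of_real (w t)))"
      using degree_residue_sum[OF A(1,2), of c] card_T degree_residue_sum[OF finT] A
      by (auto simp: P_def)
    fix t assume t: "t \<in> T"
    have "poly P t = poly Q t / of_real x" using P_z[OF T_A[OF t]] T_G[OF t] by simp
    moreover have "poly (residue_sum T (\<lambda>t. of_real (w t))) t = of_real (w t) * poly (pderiv R) t"
      using finT t by (simp add: poly_residue_sum_root pderiv_root_prod R_T)
    moreover have "of_real (w t) * poly (pderiv R) t = poly Q t / of_real x"
      unfolding R'[OF t] w_def using x W_pos[OF t] by (simp add: field_simps power2_eq_square)
    ultimately show "poly P t = poly (residue_sum T (\<lambda>t. of_real (w t))) t" by simp
  qed
  define T' where "T' = Re ` T"
  have inj: "inj_on Re T" using T_real by (auto simp: inj_on_def complex_eq_iff)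
  have w_Re: "w (of_real (Re t)) = w t" for t by (simp add: w_def W_def)
  have "1 / (1 / G z - of_real x) = (\<Sum>t\<in>T'. of_real (w (of_real t)) / (z - of_real t))" if z: "Im z > 0" for z
  proof -
    have zA: "z \<notin> A" using notA z by auto
    have zT: "z \<notin> T" using T_real z by fastforce
    have "poly Q z * G z = poly R z * (\<Sum>t\<in>T. of_real (w t) / (z - t))"
      using poly_residue_sum[OF finT zT] P_z[OF zA] P_T R_T by simp
    then have "G z = (1 - of_real x * G z) * (\<Sum>t\<in>T. of_real (w t) / (z - t))"
      using R_z[OF zA] Q_z[OF zA] by simp
    moreover have "1 - of_real x * G z \<noteq> 0" using zT R_z[OF zA] by (auto simp: T_def)
    moreover have "G z \<noteq> 0" using Im_G[of z] z by auto
    ultimately have "1 / (1 / G z - of_real x) = (\<Sum>t\<in>T. of_real (w t) / (z - t))"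
      by (simp add: field_simps)
    also have "\<dots> = (\<Sum>t\<in>T. of_real (w (of_real (Re t))) / (z - of_real (Re t)))"
    proof (rule sum.cong[OF refl])
      fix t assume "t \<in> T"
      then have "complex_of_real (Re t) = t" using T_real by (simp add: complex_eq_iff)
      then show "of_real (w t) / (z - t) = of_real (w (of_real (Re t))) / (z - of_real (Re t))"
        by simp
    qed
    also have "\<dots> = (\<Sum>t\<in>T'. of_real (w (of_real t)) / (z - of_real t))"
      unfolding T'_def by (subst sum.reindex[OF inj]) simp
    finally show ?thesis .
  qed
  moreover have "(\<Sum>t\<in>T'. w (of_real t)) = 1"
  proof -
    have "complex_of_real (\<Sum>t\<in>T. w t) = (\<Sum>s\<in>A. c s)"
      using coeff_residue_sum[OF finT, of "\<lambda>t. of_real (w t)"] coeff_residue_sum[OF A(1), of c] P_T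
      by (simp add: P_def card_T)
    also have "\<dots> = complex_of_real (\<Sum>s\<in>S. q s)"
      unfolding A_def by (subst sum.reindex) (auto simp: inj_on_def c_def)
    finally have "(\<Sum>t\<in>T. w t) = 1" using q(2) by (simp only: of_real_eq_iff)
    then show ?thesis unfolding T'_def by (subst sum.reindex[OF inj]) (simp add: w_Re)
  qed
  moreover have "\<forall>t\<in>T'. 0 \<le> w (of_real t)"
  proof -
    have "0 \<le> w t" if "t \<in> T" for t using W_pos[OF that] by (simp add: w_def)
    then show ?thesis by (auto simp: T'_def w_Re)
  qed
  moreover have "finite T'" using finT by (simp add: T'_def)
  ultimately show ?thesis by (intro exI[of _ T'] exI[of _ "\<lambda>t. w (of_real t)"]) auto
qed

text \<open>The right-hand side is affine in the first measure, so the convolution is the mixture,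
  with the weights of the first measure, of the measures obtained for point masses.\<close>

lemma finite_range_mconv:
  assumes \<mu>: "real_prob \<mu>" and \<nu>: "real_prob \<nu>"
    and f[measurable]: "f \<in> borel_measurable borel" and fin: "finite (range f)"
  shows "\<exists>\<rho>. real_prob \<rho> \<and> (\<forall>z. Im z > 0 \<longrightarrow>
    cauchy_tr \<rho> z = cauchy_tr (distr \<mu> borel f) (H_tr (distr \<nu> borel f) z))"
proof -
  define p where "p v = measure \<mu> (f -` {v})" for v
  define q where "q v = measure \<nu> (f -` {v})" for v
  \<comment> \<open>Values taken with probability zero are dropped, because the case of a point mass
    needs strictly positive weights.\<close>
  define S where "S = {v \<in> range f. q v > 0}"
  define G where "G z = (\<Sum>s\<in>S. complex_of_real (q s) / (z - of_real s))" for z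
  have finS: "finite S" using fin by (simp add: S_def)
  have qz: "q v = 0" if "v \<in> range f - S" for v
    using that measure_nonneg[of \<nu> "f -` {v}"] by (auto simp: S_def q_def less_le)
  have G: "cauchy_tr (distr \<nu> borel f) z = G z" for z
  proof -
    have "cauchy_tr (distr \<nu> borel f) z = (\<Sum>v\<in>range f. of_real (q v) * (1 / (z - of_real v)))"
      unfolding cauchy_tr_distr[OF \<nu> f] q_def by (rule integral_finite_range(1)[OF \<nu> f fin])
    also have "\<dots> = (\<Sum>v\<in>S. of_real (q v) * (1 / (z - of_real v)))"
      by (rule sum.mono_neutral_right) (use fin qz in \<open>auto simp: S_def\<close>)
    finally show ?thesis by (simp add: G_def)
  qed
  have q1: "(\<Sum>s\<in>S. q s) = 1"
  proof -
    have "(\<Sum>s\<in>S. q s) = (\<Sum>s\<in>range f. q s)"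
      by (rule sum.mono_neutral_left) (use fin qz in \<open>auto simp: S_def\<close>)
    then show ?thesis using integral_finite_range(2)[OF \<nu> f fin] by (simp add: q_def)
  qed
  define D where "D x T w \<longleftrightarrow> finite T \<and> (\<forall>t\<in>T. 0 \<le> w t) \<and> (\<Sum>t\<in>T. w t) = (1::real) \<and>
    (\<forall>z. Im z > 0 \<longrightarrow> 1 / (1 / G z - of_real x) = (\<Sum>t\<in>T. complex_of_real (w t) / (z - of_real t)))" for x T w
  have "\<exists>T w. D x T w" for x
    unfolding D_def G_def by (intro finite_support_delta_mconv finS q1) (auto simp: S_def)
  then obtain T w where D: "\<And>x. D x (T x) (w x)" by metis
  have T: "\<And>x. finite (T x)" "\<And>x t. t \<in> T x \<Longrightarrow> 0 \<le> w x t" "\<And>x. (\<Sum>t\<in>T x. w x t) = (1::real)"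
    "\<And>x z. Im z > 0 \<Longrightarrow> 1 / (1 / G z - of_real x) = (\<Sum>t\<in>T x. complex_of_real (w x t) / (z - of_real t))"
    using D unfolding D_def by blast+
  obtain \<rho> where "real_prob \<rho>" and \<rho>: "\<And>z. Im z > 0 \<Longrightarrow> cauchy_tr \<rho> z =
      (\<Sum>i\<in>Sigma (range f) T. of_real ((\<lambda>(x, t). p x * w x t) i) / (z - of_real (snd i)))"
  proof (rule finite_support_cauchy_tr[of "Sigma (range f) T" "\<lambda>(x, t). p x * w x t" snd])
    show "finite (Sigma (range f) T)" using fin T(1) by auto
    show "0 \<le> (case i of (x, t) \<Rightarrow> p x * w x t)" if "i \<in> Sigma (range f) T" for i
      using that T(2) by (auto simp: p_def)
    have "(\<Sum>i\<in>Sigma (range f) T. case i of (x, t) \<Rightarrow> p x * w x t) = (\<Sum>x\<in>range f. p x * (\<Sum>t\<in>T x. w x t))"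
      using fin T(1) by (simp add: sum.Sigma[symmetric] sum_distrib_left)
    then show "(\<Sum>i\<in>Sigma (range f) T. case i of (x, t) \<Rightarrow> p x * w x t) = 1"
      using integral_finite_range(2)[OF \<mu> f fin] by (simp add: T(3) p_def)
  qed blast
  moreover have "cauchy_tr \<rho> z = cauchy_tr (distr \<mu> borel f) (H_tr (distr \<nu> borel f) z)" if z: "Im z > 0" for z
  proof -
    have "cauchy_tr \<rho> z = (\<Sum>(x, t)\<in>Sigma (range f) T. of_real (p x) * (of_real (w x t) / (z - of_real t)))"
      unfolding \<rho>[OF z] by (intro sum.cong) auto
    also have "\<dots> = (\<Sum>x\<in>range f. of_real (p x) * (\<Sum>t\<in>T x. of_real (w x t) / (z - of_real t)))"
      using fin T(1) by (simp add: sum.Sigma[symmetric] sum_distrib_left)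
    also have "\<dots> = (\<Sum>x\<in>range f. of_real (p x) * (1 / (H_tr (distr \<nu> borel f) z - of_real x)))"
      using T(4)[OF z] by (simp add: H_tr_def G)
    also have "\<dots> = cauchy_tr (distr \<mu> borel f) (H_tr (distr \<nu> borel f) z)"
      unfolding cauchy_tr_distr[OF \<mu> f] p_def by (rule integral_finite_range(1)[OF \<mu> f fin, symmetric])
    finally show ?thesis .
  qed
  ultimately show ?thesis by blast
qed

section \<open>Tightness and limits of Cauchy transforms\<close>

lemma tail_bound:
  assumes "real_prob \<rho>" "y > 0"
  shows "2 * Re (\<i> * of_real y * cauchy_tr \<rho> (\<i> * of_real y)) - 1 \<le> measure \<rho> {-y<..y}"
proof -
  interpret real_distribution \<rho> using assms by (simp add: real_prob_iff)
  have Imz: "Im (\<i> * of_real y) > 0" using assms(2) by simp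
  have "\<i> * of_real y * cauchy_tr \<rho> (\<i> * of_real y)
      = (\<integral>x. \<i> * of_real y * (1 / (\<i> * of_real y - complex_of_real x)) \<partial>\<rho>)"
    unfolding cauchy_tr_def by (rule integral_mult_right_zero[symmetric])
  then have "Re (\<i> * of_real y * cauchy_tr \<rho> (\<i> * of_real y))
      = (\<integral>x. Re (\<i> * of_real y * (1 / (\<i> * of_real y - complex_of_real x))) \<partial>\<rho>)"
    by (simp only: integral_Re[OF integrable_mult_right[OF integrable_resolvent[OF assms(1) Imz]]])
  \<comment> \<open>The real part of the integrand is y^2 / (x^2 + y^2), which is at most 1, and at
    most 1/2 once |x| is at least y. So a real part near 1 at a single point of the axis leaves
    little mass in the tails.\<close>
  also have "\<dots> \<le> (\<integral>x. 1 / 2 + 1 / 2 * indicator {-y<..y} x \<partial>\<rho>)"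
  proof (rule integral_mono)
    show "integrable \<rho> (\<lambda>x. Re (\<i> * of_real y * (1 / (\<i> * of_real y - complex_of_real x))))"
      by (rule integrable_Re[OF integrable_mult_right[OF integrable_resolvent[OF assms(1) Imz]]])
    show "integrable \<rho> (\<lambda>x. 1 / 2 + 1 / 2 * indicator {-y<..y} x :: real)"
      by (auto simp: emeasure_eq_measure)
    fix x
    have "Re (\<i> * of_real y * (1 / (\<i> * of_real y - complex_of_real x))) = y\<^sup>2 / (x\<^sup>2 + y\<^sup>2)"
      by (simp add: Re_divide power2_eq_square)
    also have "\<dots> \<le> 1 / 2 + 1 / 2 * indicator {-y<..y} x"
    proof (cases "x \<in> {-y<..y}")
      case True
      moreover have "x\<^sup>2 + y\<^sup>2 > 0" using assms(2) by (simp add: sum_power2_gt_zero_iff)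
      ultimately show ?thesis by (simp add: divide_simps)
    next
      case False
      then have "y \<le> \<bar>x\<bar>" by auto
      then have "y\<^sup>2 \<le> x\<^sup>2" using assms(2) by (simp add: abs_le_square_iff[symmetric])
      moreover have "x\<^sup>2 + y\<^sup>2 > 0" using assms(2) by (simp add: sum_power2_gt_zero_iff)
      ultimately show ?thesis using False by (simp add: divide_simps)
    qed
    finally show "Re (\<i> * of_real y * (1 / (\<i> * of_real y - complex_of_real x)))
      \<le> 1 / 2 + 1 / 2 * indicator {-y<..y} x" .
  qed
  also have "\<dots> = 1 / 2 + 1 / 2 * measure \<rho> {-y<..y}"
    by (subst Bochner_Integration.integral_add) (auto simp: emeasure_eq_measure)
  finally show ?thesis by simp
qed

text \<open>Tightness of a single measure, needed for the finitely many indices before convergence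
  at a point of the axis takes hold.\<close>

lemma eventually_tail:
  assumes "real_prob \<rho>" "e > 0"
  shows "\<forall>\<^sub>F m in sequentially. 1 - e < measure \<rho> {-real m<..real m}"
proof -
  interpret real_distribution \<rho> using assms by (simp add: real_prob_iff)
  have "(\<lambda>m. measure \<rho> {-real m<..real m}) \<longlonglongrightarrow> measure \<rho> (\<Union>m. {-real m<..real m})"
    by (rule finite_Lim_measure_incseq) (auto simp: incseq_def)
  also have "(\<Union>m. {-real m<..real m}) = UNIV"
  proof -
    have "\<exists>m. x \<in> {-real m<..real m}" for x
    proof -
      obtain m where "\<bar>x\<bar> < real m" using reals_Archimedean2 by blast
      then show ?thesis by (intro exI[of _ m]) auto
    qed
    then show ?thesis by blast
  qed
  finally have "(\<lambda>m. measure \<rho> {-real m<..real m}) \<longlonglongrightarrow> 1" by simp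
  then show ?thesis by (rule order_tendstoD) (use assms(2) in simp)
qed

text \<open>Pointwise limits of transforms may lose mass at infinity; the condition on the imaginary
  axis excludes this, since it yields tightness through \<open>tail_bound\<close>. A weakly
  convergent subsequence then suffices, because the transforms converge along the whole
  sequence.\<close>

theorem cauchy_tr_limit:
  assumes \<rho>: "\<And>n. real_prob (\<rho> n)"
    and lim: "\<And>z. Im z > 0 \<Longrightarrow> (\<lambda>n. cauchy_tr (\<rho> n) z) \<longlonglongrightarrow> F z"
    and F: "(\<lambda>m. \<i> * of_real (real (Suc m)) * F (\<i> * of_real (real (Suc m)))) \<longlonglongrightarrow> 1"
  shows "\<exists>\<sigma>. real_prob \<sigma> \<and> (\<forall>z. Im z > 0 \<longrightarrow> cauchy_tr \<sigma> z = F z)"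
proof -
  have dist: "real_distribution (\<rho> n)" for n using \<rho> by (simp add: real_prob_iff)
  have "tight \<rho>"
    unfolding tight_def
  proof (intro conjI allI impI dist)
    fix e :: real assume e: "e > 0"
    have "(\<lambda>m. Re (\<i> * of_real (real (Suc m)) * F (\<i> * of_real (real (Suc m))))) \<longlonglongrightarrow> Re 1"
      by (rule tendsto_Re[OF F])
    \<comment> \<open>The bound \<open>2 * Re - 1\<close> of \<open>tail_bound\<close> doubles the
      defect, hence \<open>e / 2\<close>.\<close>
    then have "\<forall>\<^sub>F m in sequentially. 1 - e / 2 < Re (\<i> * of_real (real (Suc m)) * F (\<i> * of_real (real (Suc m))))"
      by (rule order_tendstoD) (use e in simp)
    from eventually_happens'[OF sequentially_bot this]
    obtain m where m: "1 - e / 2 < Re (\<i> * of_real (real (Suc m)) * F (\<i> * of_real (real (Suc m))))"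
      by blast
    let ?z = "\<i> * complex_of_real (real (Suc m))"
    have "(\<lambda>n. Re (?z * cauchy_tr (\<rho> n) ?z)) \<longlonglongrightarrow> Re (?z * F ?z)"
      by (intro tendsto_Re tendsto_mult tendsto_const lim) simp
    from order_tendstoD(1)[OF this m] obtain n0 where
      n0: "\<And>n. n \<ge> n0 \<Longrightarrow> 1 - e / 2 < Re (?z * cauchy_tr (\<rho> n) ?z)"
      unfolding eventually_sequentially by blast
    have "\<forall>\<^sub>F k in sequentially. \<forall>n\<in>{..<n0}. 1 - e < measure (\<rho> n) {-real k<..real k}"
      by (intro eventually_ball_finite ballI eventually_tail \<rho> e) auto
    then have "\<forall>\<^sub>F k in sequentially. Suc m \<le> k \<and> (\<forall>n\<in>{..<n0}. 1 - e < measure (\<rho> n) {-real k<..real k})"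
      by (intro eventually_conj eventually_ge_at_top)
    from eventually_happens'[OF sequentially_bot this]
    obtain k where k: "Suc m \<le> k" "\<And>n. n < n0 \<Longrightarrow> 1 - e < measure (\<rho> n) {-real k<..real k}"
      by blast
    have "1 - e < measure (\<rho> n) {-real k<..real k}" for n
    proof (cases "n < n0")
      case False
      interpret real_distribution "\<rho> n" by (rule dist)
      have "1 - e < measure (\<rho> n) {-real (Suc m)<..real (Suc m)}"
        using n0[of n] False tail_bound[OF \<rho>, of "real (Suc m)" n] by simp
      also have "\<dots> \<le> measure (\<rho> n) {-real k<..real k}"
        using k(1) by (intro finite_measure_mono) auto
      finally show ?thesis .
    qed (use k in auto)
    moreover have "-real k < real k" using k(1) by simp
    ultimately show "\<exists>a b. a < b \<and> (\<forall>n. 1 - e < measure (\<rho> n) {a<..b})" by blast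
  qed
  from tight_imp_convergent_subsubsequence[OF this strict_mono_id]
  obtain r \<sigma> where r: "strict_mono r" and \<sigma>: "real_distribution \<sigma>" "weak_conv_m (\<rho> \<circ> id \<circ> r) \<sigma>"
    by blast
  have "cauchy_tr \<sigma> z = F z" if z: "Im z > 0" for z
  proof -
    have "(\<lambda>n. \<integral>x. 1 / (z - complex_of_real x) \<partial>(\<rho> \<circ> id \<circ> r) n) \<longlonglongrightarrow> (\<integral>x. 1 / (z - complex_of_real x) \<partial>\<sigma>)"
    proof (rule weak_conv_imp_integral_bdd_continuous_conv[OF _ \<sigma>])
      show "isCont (\<lambda>x. 1 / (z - complex_of_real x)) x" for x
        using resolvent_nz[OF z, of x] by (intro continuous_intros) auto
      show "norm (1 / (z - complex_of_real x)) \<le> 1 / Im z" for x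
        by (rule norm_resolvent_le[OF z])
    qed (simp add: dist)
    moreover have "(\<lambda>n. cauchy_tr (\<rho> (r n)) z) \<longlonglongrightarrow> F z"
      using LIMSEQ_subseq_LIMSEQ[OF lim[OF z] r] by (simp add: o_def)
    ultimately show ?thesis
      using LIMSEQ_unique unfolding cauchy_tr_def by (fastforce simp: o_def)
  qed
  then show ?thesis using \<sigma>(1) by (auto simp: real_prob_iff)
qed

section \<open>Approximation by measures of finite support\<close>

definition grid_approx :: "nat \<Rightarrow> real \<Rightarrow> real" where
  "grid_approx n x = (if \<bar>x\<bar> \<le> real (Suc n) then of_int \<lfloor>real (Suc n) * x\<rfloor> / real (Suc n) else 0)"

lemma grid_approx_measurable [measurable]: "grid_approx n \<in> borel_measurable borel"
  unfolding grid_approx_def by measurable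

lemma finite_range_grid_approx: "finite (range (grid_approx n))"
proof (rule finite_subset)
  let ?N = "int (Suc n)"
  show "range (grid_approx n) \<subseteq> insert 0 ((\<lambda>k. of_int k / real (Suc n)) ` {- ?N * ?N - 1 .. ?N * ?N})"
  proof
    fix v assume "v \<in> range (grid_approx n)"
    then obtain x where v: "v = grid_approx n x" by blast
    show "v \<in> insert 0 ((\<lambda>k. of_int k / real (Suc n)) ` {- ?N * ?N - 1 .. ?N * ?N})"
    proof (cases "\<bar>x\<bar> \<le> real (Suc n)")
      case True
      have "\<bar>real (Suc n) * x\<bar> \<le> real (Suc n) * real (Suc n)"
        using True unfolding abs_mult by (intro mult_mono) auto
      then have *: "real_of_int (- (?N * ?N)) \<le> real (Suc n) * x" "real (Suc n) * x \<le> real_of_int (?N * ?N)"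
        unfolding abs_le_iff by (auto simp del: of_nat_Suc)
      then have "- (?N * ?N) \<le> \<lfloor>real (Suc n) * x\<rfloor>" "\<lfloor>real (Suc n) * x\<rfloor> \<le> ?N * ?N"
        using floor_mono[OF *(2)] by (simp_all only: le_floor_iff floor_of_int)
      then have "\<lfloor>real (Suc n) * x\<rfloor> \<in> {- ?N * ?N - 1 .. ?N * ?N}" by (auto simp del: of_nat_Suc)
      then show ?thesis using True v by (simp only: grid_approx_def if_True) blast
    qed (simp add: v grid_approx_def)
  qed
qed auto

lemma grid_approx_tendsto: "(\<lambda>n. grid_approx n x) \<longlonglongrightarrow> x"
proof -
  have "\<forall>\<^sub>F n in sequentially. norm (grid_approx n x - x) \<le> inverse (real (Suc n))"
  proof -
    obtain N where N: "\<bar>x\<bar> \<le> real N" using real_arch_simple by blast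
    have "norm (grid_approx n x - x) \<le> inverse (real (Suc n))" if "n \<ge> N" for n
    proof -
      have "\<bar>x\<bar> \<le> real (Suc n)" using N that by linarith
      then have "grid_approx n x - x = (of_int \<lfloor>real (Suc n) * x\<rfloor> - real (Suc n) * x) / real (Suc n)"
        by (simp add: grid_approx_def diff_divide_distrib del: of_nat_Suc)
      moreover have "\<bar>of_int \<lfloor>real (Suc n) * x\<rfloor> - real (Suc n) * x\<bar> \<le> 1" by linarith
      ultimately show ?thesis
        by (simp add: inverse_eq_divide divide_right_mono del: of_nat_Suc)
    qed
    then show ?thesis unfolding eventually_sequentially by blast
  qed
  then have "(\<lambda>n. grid_approx n x - x) \<longlonglongrightarrow> 0"
    by (rule Lim_null_comparison[OF _ LIMSEQ_inverse_real_of_nat])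
  then show ?thesis by (simp add: LIM_zero_iff)
qed

text \<open>The evaluation points move with n because the outer transform is taken at the
  H-transform of the approximated inner measure. A common lower bound on imaginary parts gives the
  dominating constant.\<close>

lemma cauchy_tr_grid_tendsto:
  assumes "real_prob \<mu>" "y > 0" "\<And>n. Im (z n) \<ge> y" "z \<longlonglongrightarrow> w"
  shows "(\<lambda>n. cauchy_tr (distr \<mu> borel (grid_approx n)) (z n)) \<longlonglongrightarrow> cauchy_tr \<mu> w"
proof -
  interpret real_distribution \<mu> using assms by (simp add: real_prob_iff)
  have w: "Im w > 0"
    using LIMSEQ_le_const[OF tendsto_Im[OF assms(4)]] assms(2,3) by (meson less_le_trans)
  show ?thesis
    unfolding cauchy_tr_distr[OF assms(1) grid_approx_measurable]
    unfolding cauchy_tr_def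
  proof (rule integral_dominated_convergence[where w = "\<lambda>_. 1 / y"])
    show "AE x in \<mu>. (\<lambda>n. 1 / (z n - complex_of_real (grid_approx n x))) \<longlonglongrightarrow> 1 / (w - complex_of_real x)"
      using resolvent_nz[OF w]
      by (intro AE_I2 tendsto_divide tendsto_const tendsto_diff tendsto_of_real assms(4) grid_approx_tendsto)
    show "AE x in \<mu>. norm (1 / (z n - complex_of_real (grid_approx n x))) \<le> 1 / y" for n
    proof (rule AE_I2)
      fix x
      have "norm (1 / (z n - complex_of_real (grid_approx n x))) \<le> 1 / Im (z n)"
        by (rule norm_resolvent_le) (use assms(2) assms(3)[of n] in linarith)
      also have "\<dots> \<le> 1 / y" using assms(2) assms(3)[of n] by (simp add: frac_le)
      finally show "norm (1 / (z n - complex_of_real (grid_approx n x))) \<le> 1 / y" .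
    qed
  qed auto
qed

text \<open>Stated for points asymptotic to the imaginary axis rather than on it, so that it serves
  for the inner measure at iy and for the outer one at H(iy).\<close>

lemma cauchy_tr_iy_tendsto:
  assumes "real_prob \<mu>" "\<And>m. Im (z m) \<ge> real (Suc m)"
    "(\<lambda>m. z m / (\<i> * of_real (real (Suc m)))) \<longlonglongrightarrow> 1"
  shows "(\<lambda>m. \<i> * of_real (real (Suc m)) * cauchy_tr \<mu> (z m)) \<longlonglongrightarrow> 1"
proof -
  interpret real_distribution \<mu> using assms by (simp add: real_prob_iff)
  let ?u = "\<lambda>m. \<i> * complex_of_real (real (Suc m))"
  have "(\<lambda>m. \<integral>x. ?u m * (1 / (z m - complex_of_real x)) \<partial>\<mu>) \<longlonglongrightarrow> (\<integral>x. 1 \<partial>\<mu>)"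
  proof (rule integral_dominated_convergence[where w = "\<lambda>_. 1"])
    show "AE x in \<mu>. (\<lambda>m. ?u m * (1 / (z m - complex_of_real x))) \<longlonglongrightarrow> 1"
    proof (rule AE_I2)
      fix x
      have "(\<lambda>m. inverse (real (Suc m)) *\<^sub>R (- \<i> * complex_of_real x)) \<longlonglongrightarrow> 0 *\<^sub>R (- \<i> * complex_of_real x)"
        by (intro tendsto_scaleR tendsto_const LIMSEQ_inverse_real_of_nat)
      moreover have "(\<lambda>m. inverse (real (Suc m)) *\<^sub>R (- \<i> * complex_of_real x)) = (\<lambda>m. complex_of_real x / ?u m)"
        by (simp add: scaleR_conv_of_real divide_inverse mult_ac del: of_nat_Suc)
      ultimately have "(\<lambda>m. complex_of_real x / ?u m) \<longlonglongrightarrow> 0" by (simp del: of_nat_Suc)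
      then have "(\<lambda>m. 1 / (z m / ?u m - complex_of_real x / ?u m)) \<longlonglongrightarrow> 1 / (1 - 0)"
        by (intro tendsto_divide tendsto_const tendsto_diff assms(3)) auto
      moreover have "1 / (z m / ?u m - complex_of_real x / ?u m) = ?u m * (1 / (z m - complex_of_real x))" for m
        by (simp add: diff_divide_distrib[symmetric] del: of_nat_Suc)
      ultimately show "(\<lambda>m. ?u m * (1 / (z m - complex_of_real x))) \<longlonglongrightarrow> 1" by (simp del: of_nat_Suc)
    qed
    show "AE x in \<mu>. norm (?u m * (1 / (z m - complex_of_real x))) \<le> 1" for m
    proof (rule AE_I2)
      fix x
      have "0 < real (Suc m)" by simp
      with assms(2)[of m] have Im: "Im (z m) > 0" by linarith
      have "norm (?u m * (1 / (z m - complex_of_real x))) = real (Suc m) * norm (1 / (z m - complex_of_real x))"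
        by (simp only: norm_mult norm_ii norm_of_real abs_of_nat mult_1)
      also have "\<dots> \<le> real (Suc m) * (1 / Im (z m))"
        by (intro mult_left_mono norm_resolvent_le Im) simp
      also have "\<dots> \<le> 1" using Im assms(2)[of m] by (simp del: of_nat_Suc)
      finally show "norm (?u m * (1 / (z m - complex_of_real x))) \<le> 1" .
    qed
  qed auto
  moreover have "(\<integral>x. ?u m * (1 / (z m - complex_of_real x)) \<partial>\<mu>) = ?u m * cauchy_tr \<mu> (z m)" for m
    unfolding cauchy_tr_def by (rule integral_mult_right_zero)
  moreover have "(\<integral>x. 1 \<partial>\<mu>) = (1::complex)" by simp
  ultimately show ?thesis by (simp only:)
qed

theorem mconv_exists:
  assumes \<mu>: "real_prob \<mu>" and \<nu>: "real_prob \<nu>"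
  shows "\<exists>\<rho>. real_prob \<rho> \<and> (\<forall>z. Im z > 0 \<longrightarrow> cauchy_tr \<rho> z = cauchy_tr \<mu> (H_tr \<nu> z))"
proof -
  define \<mu>' \<nu>' where "\<mu>' n = distr \<mu> borel (grid_approx n)" and "\<nu>' n = distr \<nu> borel (grid_approx n)" for n
  have \<nu>': "real_prob (\<nu>' n)" for n
  proof -
    interpret real_distribution \<nu> using \<nu> by (simp add: real_prob_iff)
    show ?thesis by (simp add: \<nu>'_def real_prob_def prob_space_distr)
  qed
  have "\<exists>\<rho>. real_prob \<rho> \<and> (\<forall>z. Im z > 0 \<longrightarrow> cauchy_tr \<rho> z = cauchy_tr (\<mu>' n) (H_tr (\<nu>' n) z))" for n
    unfolding \<mu>'_def \<nu>'_def
    by (rule finite_range_mconv[OF \<mu> \<nu> grid_approx_measurable finite_range_grid_approx])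
  then obtain \<rho> where \<rho>: "\<And>n. real_prob (\<rho> n)"
    "\<And>n z. Im z > 0 \<Longrightarrow> cauchy_tr (\<rho> n) z = cauchy_tr (\<mu>' n) (H_tr (\<nu>' n) z)" by metis
  show ?thesis
  proof (rule cauchy_tr_limit[OF \<rho>(1)])
    fix z assume z: "Im z > 0"
    have "(\<lambda>n. H_tr (\<nu>' n) z) \<longlonglongrightarrow> H_tr \<nu> z"
      unfolding H_tr_def \<nu>'_def
      by (intro tendsto_divide tendsto_const cauchy_tr_grid_tendsto[OF \<nu> z] cauchy_tr_nz[OF \<nu> z]) auto
    then show "(\<lambda>n. cauchy_tr (\<rho> n) z) \<longlonglongrightarrow> cauchy_tr \<mu> (H_tr \<nu> z)"
      unfolding \<rho>(2)[OF z] unfolding \<mu>'_def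
      by (intro cauchy_tr_grid_tendsto[OF \<mu> z]) (use Im_H_tr_ge[OF \<nu>' z] in auto)
  next
    \<comment> \<open>No mass escapes: iy times the inner transform tends to 1, so the inner
      H-transform is asymptotic to iy, and the outer transform has the same limit at those
      points.\<close>
    let ?u = "\<lambda>m. \<i> * complex_of_real (real (Suc m))"
    have "(\<lambda>m. ?u m * cauchy_tr \<nu> (?u m)) \<longlonglongrightarrow> 1"
      by (rule cauchy_tr_iy_tendsto[OF \<nu>]) (auto simp del: of_nat_Suc)
    then have "(\<lambda>m. 1 / (?u m * cauchy_tr \<nu> (?u m))) \<longlonglongrightarrow> 1 / 1"
      by (intro tendsto_divide tendsto_const) auto
    then have "(\<lambda>m. H_tr \<nu> (?u m) / ?u m) \<longlonglongrightarrow> 1"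
      by (simp add: H_tr_def mult.commute del: of_nat_Suc)
    moreover have "real (Suc m) \<le> Im (H_tr \<nu> (?u m))" for m
      using Im_H_tr_ge[OF \<nu>, of "?u m"] by simp
    ultimately show "(\<lambda>m. ?u m * cauchy_tr \<mu> (H_tr \<nu> (?u m))) \<longlonglongrightarrow> 1"
      by (intro cauchy_tr_iy_tendsto[OF \<mu>])
  qed
qed

text \<open>Reciprocals are injective even at 0, where \<open>1 / 0 = 0\<close>, so the equation may
  be read for Cauchy transforms.\<close>

lemma is_mconv_iff:
  "is_mconv \<mu> \<nu> \<rho> \<longleftrightarrow> real_prob \<rho> \<and> (\<forall>z. Im z > 0 \<longrightarrow> cauchy_tr \<rho> z = cauchy_tr \<mu> (H_tr \<nu> z))"
  by (auto simp: is_mconv_def H_tr_def)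

lemma is_mconv_mconv:
  assumes "real_prob \<mu>" "real_prob \<nu>"
  shows "is_mconv \<mu> \<nu> (mconv \<mu> \<nu>)"
proof -
  have "\<exists>!\<rho>. is_mconv \<mu> \<nu> \<rho>"
    using mconv_exists[OF assms] cauchy_tr_unique unfolding is_mconv_iff by metis
  then show ?thesis unfolding mconv_def by (rule theI')
qed

lemma real_prob_mconv: "real_prob \<mu> \<Longrightarrow> real_prob \<nu> \<Longrightarrow> real_prob (mconv \<mu> \<nu>)"
  and cauchy_tr_mconv: "real_prob \<mu> \<Longrightarrow> real_prob \<nu> \<Longrightarrow> Im z > 0 \<Longrightarrow>
    cauchy_tr (mconv \<mu> \<nu>) z = cauchy_tr \<mu> (H_tr \<nu> z)"
  using is_mconv_mconv by (auto simp: is_mconv_iff)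

lemma real_prob_mpow: "real_prob \<mu> \<Longrightarrow> real_prob (mpow \<mu> N)"
proof (induction N)
  case 0
  show ?case by (simp add: real_prob_def prob_space_return)
qed (simp add: real_prob_mconv)

section \<open>Asymptotic expansions and moments\<close>

abbreviation iy :: "real \<Rightarrow> complex" where "iy y \<equiv> \<i> * of_real y"

text \<open>\<open>expands n f p\<close>: as \<open>y \<rightarrow> \<infinity>\<close>, \<open>f y\<close> is the truncation of \<open>p\<close> to degree less than \<open>n\<close> at \<open>1 / iy y\<close>, up to
  \<open>O(y\<^sup>-\<^sup>n)\<close>.\<close>

fun expands :: "nat \<Rightarrow> (real \<Rightarrow> complex) \<Rightarrow> complex fps \<Rightarrow> bool" where
  "expands 0 f p \<longleftrightarrow> (\<exists>C. \<forall>y\<ge>1. norm (f y) \<le> C)"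
| "expands (Suc n) f p \<longleftrightarrow> expands n (\<lambda>y. (f y - fps_nth p 0) * iy y) (fps_shift 1 p)"

lemma expands_cong:
  assumes "expands n f p" "\<And>y. y \<ge> 1 \<Longrightarrow> f y = g y" "\<And>k. k < n \<Longrightarrow> fps_nth p k = fps_nth q k"
  shows "expands n g q"
  using assms
proof (induction n arbitrary: f g p q)
  case 0
  then show ?case by force
next
  case (Suc n)
  have "expands n (\<lambda>y. (g y - fps_nth q 0) * iy y) (fps_shift 1 q)"
  proof (rule Suc.IH)
    show "expands n (\<lambda>y. (f y - fps_nth p 0) * iy y) (fps_shift 1 p)" using Suc.prems(1) by simp
    show "(f y - fps_nth p 0) * iy y = (g y - fps_nth q 0) * iy y" if "y \<ge> 1" for y
      using Suc.prems(2)[OF that] Suc.prems(3)[of 0] by simp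
    show "fps_nth (fps_shift 1 p) k = fps_nth (fps_shift 1 q) k" if "k < n" for k
      using Suc.prems(3)[of "Suc k"] that by simp
  qed
  then show ?case by simp
qed

lemma expands_0 [simp]: "expands n (\<lambda>_. 0) 0"
  by (induction n) auto

lemma expands_const: "expands n (\<lambda>_. c) (fps_const c)"
proof (cases n)
  case (Suc m)
  have "fps_shift 1 (fps_const c) = 0" by (rule fps_ext) auto
  then show ?thesis using Suc by simp
qed auto

lemma expands_X: "expands n (\<lambda>y. 1 / iy y) fps_X"
proof (cases n)
  case 0
  have "norm (1 / iy y) \<le> 1" if "y \<ge> 1" for y
    using that by (simp add: norm_divide norm_mult)
  then show ?thesis using 0 by auto
next
  case (Suc m)
  have "fps_shift 1 (fps_X :: complex fps) = fps_const 1" by (rule fps_ext) (auto simp: fps_X_def)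
  then have "expands m (\<lambda>y. (1 / iy y - fps_nth fps_X 0) * iy y) (fps_shift 1 fps_X)"
    by (intro expands_cong[OF expands_const[of m 1]]) auto
  then show ?thesis using Suc by simp
qed

lemma expands_add:
  assumes "expands n f p" "expands n g q"
  shows "expands n (\<lambda>y. f y + g y) (p + q)"
  using assms
proof (induction n arbitrary: f g p q)
  case 0
  then obtain C D where "\<forall>y\<ge>1. norm (f y) \<le> C" "\<forall>y\<ge>1. norm (g y) \<le> D" by auto
  then have "\<forall>y\<ge>1. norm (f y + g y) \<le> C + D" by (meson add_mono norm_triangle_le)
  then show ?case by auto
next
  case (Suc n)
  from Suc.IH[OF Suc.prems(1)[unfolded expands.simps] Suc.prems(2)[unfolded expands.simps]]
  have "expands n (\<lambda>y. (f y + g y - fps_nth (p + q) 0) * iy y) (fps_shift 1 (p + q))"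
    by (rule expands_cong) (auto simp: algebra_simps)
  then show ?case by simp
qed

lemma expands_cmult:
  assumes "expands n f p"
  shows "expands n (\<lambda>y. c * f y) (fps_const c * p)"
  using assms
proof (induction n arbitrary: f p)
  case 0
  then obtain C where "\<forall>y\<ge>1. norm (f y) \<le> C" by auto
  then have "\<forall>y\<ge>1. norm (c * f y) \<le> norm c * C" by (simp add: norm_mult mult_left_mono)
  then show ?case unfolding expands.simps by blast
next
  case (Suc n)
  from Suc.IH[OF Suc.prems[unfolded expands.simps]]
  have "expands n (\<lambda>y. (c * f y - fps_nth (fps_const c * p) 0) * iy y) (fps_shift 1 (fps_const c * p))"
    by (rule expands_cong) (auto simp: algebra_simps)
  then show ?case by simp
qed

lemma expands_Suc_0:
  assumes "expands (Suc n) f p"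
  shows "\<exists>C. \<forall>y\<ge>1. norm (f y - fps_nth p 0) \<le> C / y"
proof -
  have "\<exists>C. \<forall>y\<ge>1. norm (f y) \<le> C" if "expands n f p" for f p
    using that
  proof (induction n arbitrary: f p)
    case (Suc n)
    then obtain C where C: "\<forall>y\<ge>1. norm ((f y - fps_nth p 0) * iy y) \<le> C" by fastforce
    have "norm (f y) \<le> C + norm (fps_nth p 0)" if "y \<ge> 1" for y
    proof -
      have "norm (f y - fps_nth p 0) * 1 \<le> norm (f y - fps_nth p 0) * y"
        using that by (intro mult_left_mono) auto
      also have "\<dots> = norm ((f y - fps_nth p 0) * iy y)" using that by (simp add: norm_mult)
      finally have "norm (f y - fps_nth p 0) \<le> C" using C that by fastforce
      then show ?thesis using norm_triangle_sub[of "f y" "fps_nth p 0"] by linarith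
    qed
    then show ?case by blast
  qed auto
  from this[OF assms[unfolded expands.simps]]
  obtain C where "\<forall>y\<ge>1. norm ((f y - fps_nth p 0) * iy y) \<le> C" by blast
  then have "\<forall>y\<ge>1. norm (f y - fps_nth p 0) \<le> C / y" by (simp add: norm_mult pos_le_divide_eq)
  then show ?thesis by blast
qed

lemma expands_decr:
  assumes "expands (Suc n) f p"
  shows "expands n f p"
  using assms
proof (induction n arbitrary: f p)
  case 0
  then obtain C where C: "\<forall>y\<ge>1. norm (f y - fps_nth p 0) \<le> C / y" using expands_Suc_0 by blast
  have "norm (f y) \<le> C + norm (fps_nth p 0)" if y: "y \<ge> 1" for y
  proof -
    have le: "norm (f y - fps_nth p 0) \<le> C / y" using C y by blast
    then have "0 \<le> C" using y by (meson norm_ge_zero order_trans zero_le_divide_iff not_one_le_zero le_less)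
    then have "C / y \<le> C" using y by (simp add: divide_le_eq mult_le_cancel_left1)
    then show ?thesis using le norm_triangle_sub[of "f y" "fps_nth p 0"] by linarith
  qed
  then show ?case by auto
next
  case (Suc n)
  then show ?case by (metis expands.simps(2))
qed

lemma expands_mult:
  assumes "expands n f p" "expands n g q"
  shows "expands n (\<lambda>y. f y * g y) (p * q)"
  using assms
proof (induction n arbitrary: f g p q)
  case 0
  then obtain C D where CD: "\<forall>y\<ge>1. norm (f y) \<le> C" "\<forall>y\<ge>1. norm (g y) \<le> D" by auto
  have "\<forall>y\<ge>1. norm (f y * g y) \<le> C * D"
    unfolding norm_mult using CD by (meson mult_mono norm_ge_zero order_trans)
  then show ?case by auto
next
  case (Suc n)
  \<comment> \<open>Discrete Leibniz rule: f g - p0 q0 = (f - p0) g + p0 (g - q0). The undivided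
    factor g is only needed to order n, hence \<open>expands_decr\<close>.\<close>
  have "p = fps_const (fps_nth p 0) + fps_X * fps_shift 1 p"
    by (rule fps_ext) (auto simp: fps_X_mult_nth)
  then have "p * q = fps_const (fps_nth p 0) * q + fps_X * (fps_shift 1 p * q)"
    by (metis (no_types) distrib_right mult.assoc)
  then have "fps_shift 1 (p * q) = fps_shift 1 p * q + fps_const (fps_nth p 0) * fps_shift 1 q"
    by (simp add: fps_eq_iff fps_X_mult_nth)
  moreover have "expands n (\<lambda>y. (f y - fps_nth p 0) * iy y * g y + fps_nth p 0 * ((g y - fps_nth q 0) * iy y))
      (fps_shift 1 p * q + fps_const (fps_nth p 0) * fps_shift 1 q)"
    by (intro expands_add expands_cmult Suc.IH)
      (use Suc.prems expands_decr[OF Suc.prems(2)] in auto)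
  ultimately have "expands n (\<lambda>y. (f y * g y - fps_nth (p * q) 0) * iy y) (fps_shift 1 (p * q))"
    by (elim expands_cong) (auto simp: algebra_simps)
  then show ?case by simp
qed

lemma expands_power: "expands n f p \<Longrightarrow> expands n (\<lambda>y. f y ^ k) (p ^ k)"
proof (induction k)
  case 0
  show ?case using expands_const[of n 1] by simp
qed (auto intro: expands_mult)

lemma expands_sum: "(\<And>i. i \<in> A \<Longrightarrow> expands n (f i) (p i)) \<Longrightarrow> expands n (\<lambda>y. \<Sum>i\<in>A. f i y) (\<Sum>i\<in>A. p i)"
  by (induction A rule: infinite_finite_induct) (auto intro: expands_add)

lemma expands_small:
  assumes "\<And>y. y \<ge> 1 \<Longrightarrow> norm (f y) \<le> C / y ^ n"
  shows "expands n f 0"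
  using assms
proof (induction n arbitrary: f)
  case (Suc n)
  have "expands n (\<lambda>y. f y * iy y) 0"
  proof (rule Suc.IH)
    fix y :: real assume y: "y \<ge> 1"
    have "norm (f y * iy y) = norm (f y) * y" using y by (simp add: norm_mult)
    also have "\<dots> \<le> C / y ^ Suc n * y"
      using Suc.prems[OF y] y by (intro mult_right_mono) auto
    finally have "norm (f y * iy y) \<le> C / y ^ Suc n * y" .
    then show "norm (f y * iy y) \<le> C / y ^ n" using y by simp
  qed
  then show ?case by simp
qed auto

lemma expands_unique:
  assumes "expands n f p" "expands n f q" "k < n"
  shows "fps_nth p k = fps_nth q k"
  using assms
proof (induction n arbitrary: f p q k)
  case (Suc n)
  obtain C where C: "\<forall>y\<ge>1. norm (f y - fps_nth p 0) \<le> C / y"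
    using expands_Suc_0[OF Suc.prems(1)] by blast
  obtain D where D: "\<forall>y\<ge>1. norm (f y - fps_nth q 0) \<le> D / y"
    using expands_Suc_0[OF Suc.prems(2)] by blast
  have "((\<lambda>y. f y - fps_nth r 0) \<longlongrightarrow> 0) at_top" if "\<forall>y\<ge>1. norm (f y - fps_nth r 0) \<le> C / y" for C r
  proof (rule Lim_null_comparison)
    show "\<forall>\<^sub>F y in at_top. norm (f y - fps_nth r 0) \<le> C / y"
      using eventually_ge_at_top[of 1] by eventually_elim (use that in auto)
    show "((\<lambda>y. C / y) \<longlongrightarrow> 0) at_top" by real_asymp
  qed
  from tendsto_diff[OF this[OF C] this[OF D]] have "((\<lambda>y::real. fps_nth q 0 - fps_nth p 0) \<longlongrightarrow> 0) at_top"
    by simp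
  then have eq: "fps_nth p 0 = fps_nth q 0" by (simp add: tendsto_const_iff)
  show ?case
  proof (cases k)
    case (Suc j)
    then show ?thesis using Suc.IH[of "\<lambda>y. (f y - fps_nth p 0) * iy y" "fps_shift 1 p" "fps_shift 1 q" j] Suc.prems eq
      by simp
  qed (use eq in simp)
qed auto

section \<open>Moments read off from the expansion of the Cauchy transform\<close>

definition moment_rem :: "real measure \<Rightarrow> nat \<Rightarrow> real \<Rightarrow> complex" where
  "moment_rem \<rho> j y = (\<integral>x. of_real (x ^ j) * (iy y / (iy y - of_real x)) \<partial>\<rho>)"

lemma norm_iy_resolvent_le: "y > 0 \<Longrightarrow> norm (iy y / (iy y - complex_of_real x)) \<le> 1"
  using norm_resolvent_le[of "iy y" x] by (simp add: norm_divide norm_mult field_simps)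

lemma moment_rem_bound:
  assumes "real_prob \<rho>" "integrable \<rho> (\<lambda>x. x ^ j)" "y > 0"
  shows "integrable \<rho> (\<lambda>x. complex_of_real (x ^ j) * (iy y / (iy y - of_real x)))"
    and "norm (moment_rem \<rho> j y) \<le> (\<integral>x. \<bar>x ^ j\<bar> \<partial>\<rho>)"
proof -
  interpret real_distribution \<rho> using assms by (simp add: real_prob_iff)
  have le: "norm (complex_of_real (x ^ j) * (iy y / (iy y - of_real x))) \<le> \<bar>x ^ j\<bar>" for x
    unfolding norm_mult[of "complex_of_real (x ^ j)"] norm_of_real using norm_iy_resolvent_le[OF assms(3), of x]
    by (intro mult_left_le) auto
  show int: "integrable \<rho> (\<lambda>x. complex_of_real (x ^ j) * (iy y / (iy y - of_real x)))"
    by (rule Bochner_Integration.integrable_bound[OF integrable_abs[OF assms(2)]]) (use le in auto)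
  have "norm (moment_rem \<rho> j y) \<le> (\<integral>x. norm (complex_of_real (x ^ j) * (iy y / (iy y - of_real x))) \<partial>\<rho>)"
    unfolding moment_rem_def by (rule integral_norm_bound)
  also have "\<dots> \<le> (\<integral>x. \<bar>x ^ j\<bar> \<partial>\<rho>)"
    by (intro integral_mono integrable_norm int integrable_abs assms(2) le)
  finally show "norm (moment_rem \<rho> j y) \<le> (\<integral>x. \<bar>x ^ j\<bar> \<partial>\<rho>)" .
qed

text \<open>From iy / (iy - x) - 1 = x / (iy - x): one unfolding of \<open>expands\<close> turns
  index j into j + 1, so these integrals are the successive remainders in the expansion of iy times
  the transform.\<close>

lemma moment_rem_Suc:
  assumes "real_prob \<rho>" "integrable \<rho> (\<lambda>x. x ^ j)" "y > 0"
  shows "(moment_rem \<rho> j y - of_real (moment \<rho> j)) * iy y = moment_rem \<rho> (Suc j) y"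
proof -
  have int: "integrable \<rho> (\<lambda>x. complex_of_real (x ^ j))" by (rule integrable_of_real[OF assms(2)])
  have m: "complex_of_real (moment \<rho> j) = (\<integral>x. complex_of_real (x ^ j) \<partial>\<rho>)"
    unfolding moment_def by (rule integral_complex_of_real[symmetric])
  have "moment_rem \<rho> j y - of_real (moment \<rho> j)
      = (\<integral>x. complex_of_real (x ^ j) * (iy y / (iy y - of_real x)) - complex_of_real (x ^ j) \<partial>\<rho>)"
    unfolding m moment_rem_def
    by (rule Bochner_Integration.integral_diff[symmetric, OF moment_rem_bound(1)[OF assms] int])
  then have "(moment_rem \<rho> j y - of_real (moment \<rho> j)) * iy y
      = (\<integral>x. (complex_of_real (x ^ j) * (iy y / (iy y - of_real x)) - complex_of_real (x ^ j)) * iy y \<partial>\<rho>)"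
    by (simp only: integral_mult_left_zero)
  also have "\<dots> = moment_rem \<rho> (Suc j) y"
    unfolding moment_rem_def
  proof (rule Bochner_Integration.integral_cong[OF refl])
    fix x
    have "iy y - complex_of_real x \<noteq> 0" using resolvent_nz[of "iy y" x] assms(3) by simp
    then show "(complex_of_real (x ^ j) * (iy y / (iy y - of_real x)) - complex_of_real (x ^ j)) * iy y
        = complex_of_real (x ^ Suc j) * (iy y / (iy y - of_real x))"
      by (simp add: field_simps)
  qed
  finally show ?thesis .
qed

lemma moment_rem_0: "moment_rem \<rho> 0 y = cauchy_tr \<rho> (iy y) * iy y"
proof -
  have "moment_rem \<rho> 0 y = (\<integral>x. 1 / (iy y - of_real x) * iy y \<partial>\<rho>)"
    unfolding moment_rem_def by (rule Bochner_Integration.integral_cong) auto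
  then show ?thesis unfolding cauchy_tr_def by (simp only: integral_mult_left_zero)
qed

definition of_real_fps :: "real fps \<Rightarrow> complex fps" where
  "of_real_fps p = Abs_fps (\<lambda>n. of_real (fps_nth p n))"

lemma of_real_fps_nth [simp]: "fps_nth (of_real_fps p) n = of_real (fps_nth p n)"
  by (simp add: of_real_fps_def)

lemma of_real_fps_mult: "of_real_fps (p * q) = of_real_fps p * of_real_fps q"
  by (rule fps_ext) (simp add: fps_mult_nth)

lemma of_real_fps_power: "of_real_fps (p ^ k) = of_real_fps p ^ k"
proof (induction k)
  case 0
  show ?case by (rule fps_ext) simp
qed (simp add: of_real_fps_mult)

definition moment_fps :: "real measure \<Rightarrow> real fps" where
  "moment_fps \<mu> = Abs_fps (\<lambda>n. if n = 0 then 0 else moment \<mu> (n - 1))"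

text \<open>What is left after N terms is the remainder of index j + N, bounded by the absolute
  moment of that order; hence integrability up to j + N.\<close>

lemma expands_moment_rem:
  assumes "real_prob \<rho>" "\<And>k. k \<le> j + N \<Longrightarrow> integrable \<rho> (\<lambda>x. x ^ k)"
  shows "expands N (moment_rem \<rho> j) (of_real_fps (fps_shift (Suc j) (moment_fps \<rho>)))"
  using assms(2)
proof (induction N arbitrary: j)
  case 0
  have "\<forall>y\<ge>1. norm (moment_rem \<rho> j y) \<le> (\<integral>x. \<bar>x ^ j\<bar> \<partial>\<rho>)"
    using moment_rem_bound(2)[OF assms(1)] 0 by auto
  then show ?case by auto
next
  case (Suc N)
  have "expands N (moment_rem \<rho> (Suc j)) (of_real_fps (fps_shift (Suc (Suc j)) (moment_fps \<rho>)))"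
    using Suc.prems by (intro Suc.IH) auto
  then have "expands N (\<lambda>y. (moment_rem \<rho> j y - of_real (moment \<rho> j)) * iy y)
      (fps_shift 1 (of_real_fps (fps_shift (Suc j) (moment_fps \<rho>))))"
    by (rule expands_cong) (use Suc.prems in \<open>auto simp: moment_rem_Suc[OF assms(1)]\<close>)
  then show ?case by (simp add: moment_fps_def)
qed

text \<open>For the induction behind Hamburger's theorem: the expansion is given and its
  coefficients below j are already known to be moments. Peeling them off leaves the tail of
  \<open>c\<close> as expansion of the j-th remainder.\<close>

lemma expands_moment_rem_shift:
  assumes "real_prob \<rho>" "\<And>k. k \<le> j \<Longrightarrow> integrable \<rho> (\<lambda>x. x ^ k)"
    "expands (N + j) (moment_rem \<rho> 0) (of_real_fps c)" "\<And>k. k < j \<Longrightarrow> fps_nth c k = moment \<rho> k"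
  shows "expands N (moment_rem \<rho> j) (of_real_fps (fps_shift j c))"
  using assms(2-)
proof (induction j arbitrary: N)
  case (Suc j)
  have "expands (Suc N) (moment_rem \<rho> j) (of_real_fps (fps_shift j c))"
    by (rule Suc.IH) (use Suc.prems in auto)
  then have "expands N (\<lambda>y. (moment_rem \<rho> j y - of_real (fps_nth c j)) * iy y) (fps_shift 1 (of_real_fps (fps_shift j c)))"
    by simp
  then show ?case
    by (rule expands_cong) (use Suc.prems(1,3) moment_rem_Suc[OF assms(1)] in auto)
qed auto

lemma integrable_power_le_even:
  assumes "real_prob \<rho>" "integrable \<rho> (\<lambda>x. x ^ (2 * n))" "k \<le> 2 * n"
  shows "integrable \<rho> (\<lambda>x. x ^ k)"
proof -
  interpret real_distribution \<rho> using assms by (simp add: real_prob_iff)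
  show ?thesis
  proof (rule Bochner_Integration.integrable_bound)
    show "integrable \<rho> (\<lambda>x. 1 + x ^ (2 * n))" using assms(2) by simp
    show "AE x in \<rho>. norm (x ^ k) \<le> norm (1 + x ^ (2 * n))"
    proof (rule AE_I2)
      fix x :: real
      have even: "\<bar>x\<bar> ^ (2 * n) = x ^ (2 * n)" by (simp add: power_mult)
      have "0 \<le> x ^ (2 * n)" by (simp add: power_mult)
      moreover have "\<bar>x\<bar> ^ k \<le> 1 + \<bar>x\<bar> ^ (2 * n)"
      proof (cases "\<bar>x\<bar> \<le> 1")
        case True
        then have "\<bar>x\<bar> ^ k \<le> 1" by (simp add: power_le_one)
        moreover have "0 \<le> \<bar>x\<bar> ^ (2 * n)" by simp
        ultimately show ?thesis by linarith
      next
        case False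
        then have "\<bar>x\<bar> ^ k \<le> \<bar>x\<bar> ^ (2 * n)" using assms(3) by (intro power_increasing) auto
        then show ?thesis by simp
      qed
      ultimately show "norm (x ^ k) \<le> norm (1 + x ^ (2 * n))" by (simp add: power_abs even)
    qed
  qed auto
qed

text \<open>Hamburger's theorem: real parts of the expansion bound
  \<open>\<integral> x\<^bsup>2n+2\<^esup> y\<^sup>2 / (x\<^sup>2 + y\<^sup>2)\<close> uniformly in \<open>y\<close>, so the next even moment is finite by monotone convergence.\<close>

lemma integrable_even_power:
  assumes \<rho>: "real_prob \<rho>" and exp: "\<And>N. expands N (moment_rem \<rho> 0) (of_real_fps c)"
  shows "integrable \<rho> (\<lambda>x. x ^ (2 * n))"
proof (induction n)
  case 0
  interpret real_distribution \<rho> using \<rho> by (simp add: real_prob_iff)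
  show ?case by simp
next
  case (Suc n)
  interpret real_distribution \<rho> using \<rho> by (simp add: real_prob_iff)
  have int: "integrable \<rho> (\<lambda>x. x ^ k)" if "k \<le> 2 * n" for k
    using integrable_power_le_even[OF \<rho> Suc that] .
  have cm: "fps_nth c k = moment \<rho> k" if "k < 2 * n" for k
    using expands_unique[OF exp[of "2 * n"] expands_moment_rem[OF \<rho>, of 0 "2 * n"] that] int
    by (simp add: moment_fps_def)
  have "expands 2 (moment_rem \<rho> (2 * n)) (of_real_fps (fps_shift (2 * n) c))"
    by (rule expands_moment_rem_shift[OF \<rho>]) (use int exp cm in auto)
  then obtain C where C: "\<And>y. y \<ge> 1 \<Longrightarrow> norm (((moment_rem \<rho> (2 * n) y - of_real (fps_nth c (2 * n))) * iy y
      - of_real (fps_nth c (Suc (2 * n)))) * iy y) \<le> C"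
    by (auto simp: numeral_2_eq_2)
  define R where "R y = Re (moment_rem \<rho> (2 * n) y)" for y
  have R: "R y = (\<integral>x. x ^ (2 * n) * (y\<^sup>2 / (x\<^sup>2 + y\<^sup>2)) \<partial>\<rho>)"
    and R_int: "integrable \<rho> (\<lambda>x. x ^ (2 * n) * (y\<^sup>2 / (x\<^sup>2 + y\<^sup>2)))" if y: "y > 0" for y
  proof -
    have *: "Re (complex_of_real (x ^ (2 * n)) * (iy y / (iy y - of_real x))) = x ^ (2 * n) * (y\<^sup>2 / (x\<^sup>2 + y\<^sup>2))" for x
    proof -
      have "Re (of_real a * w) = a * Re w" for a w by simp
      then have "Re (complex_of_real (x ^ (2 * n)) * (iy y / (iy y - of_real x)))
          = x ^ (2 * n) * Re (iy y / (iy y - of_real x))" by blast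
      then show ?thesis by (simp add: Re_divide power2_eq_square)
    qed
    note i = moment_rem_bound(1)[OF \<rho> Suc y]
    show "R y = (\<integral>x. x ^ (2 * n) * (y\<^sup>2 / (x\<^sup>2 + y\<^sup>2)) \<partial>\<rho>)"
      unfolding R_def moment_rem_def integral_Re[OF i, symmetric] * ..
    show "integrable \<rho> (\<lambda>x. x ^ (2 * n) * (y\<^sup>2 / (x\<^sup>2 + y\<^sup>2)))"
      using integrable_Re[OF i] unfolding * .
  qed
  \<comment> \<open>The coefficient of index 2n + 1 is real, so its term is purely imaginary after
    multiplication by iy and drops out of the real part. This is why two more terms of the expansion
    give a deviation of order y^-2.\<close>
  have bound: "\<bar>R y - fps_nth c (2 * n)\<bar> * y\<^sup>2 \<le> C" if y: "y \<ge> 1" for y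
  proof -
    have "Re (((moment_rem \<rho> (2 * n) y - of_real (fps_nth c (2 * n))) * iy y
      - of_real (fps_nth c (Suc (2 * n)))) * iy y) = - ((R y - fps_nth c (2 * n)) * y\<^sup>2)"
      by (simp add: R_def algebra_simps power2_eq_square)
    with order_trans[OF abs_Re_le_cmod C[OF y]]
    have "\<bar>(R y - fps_nth c (2 * n)) * y\<^sup>2\<bar> \<le> C" by (simp only: abs_minus_cancel)
    then show ?thesis by (simp add: abs_mult)
  qed
  have lim: "(\<lambda>m. R (real (Suc m))) \<longlonglongrightarrow> moment \<rho> (2 * n)"
  proof -
    have "(\<lambda>m. \<integral>x. x ^ (2 * n) * ((real (Suc m))\<^sup>2 / (x\<^sup>2 + (real (Suc m))\<^sup>2)) \<partial>\<rho>) \<longlonglongrightarrow> (\<integral>x. x ^ (2 * n) \<partial>\<rho>)"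
    proof (rule integral_dominated_convergence[where w = "\<lambda>x. x ^ (2 * n)"])
      show "AE x in \<rho>. (\<lambda>m. x ^ (2 * n) * ((real (Suc m))\<^sup>2 / (x\<^sup>2 + (real (Suc m))\<^sup>2))) \<longlonglongrightarrow> x ^ (2 * n)"
      proof (rule AE_I2)
        fix x :: real
        have "(\<lambda>m. (real (Suc m))\<^sup>2 / (x\<^sup>2 + (real (Suc m))\<^sup>2)) \<longlonglongrightarrow> 1" by real_asymp
        from tendsto_mult_left[OF this, of "x ^ (2 * n)"]
        show "(\<lambda>m. x ^ (2 * n) * ((real (Suc m))\<^sup>2 / (x\<^sup>2 + (real (Suc m))\<^sup>2))) \<longlonglongrightarrow> x ^ (2 * n)" by simp
      qed
      show "AE x in \<rho>. norm (x ^ (2 * n) * ((real (Suc m))\<^sup>2 / (x\<^sup>2 + (real (Suc m))\<^sup>2))) \<le> x ^ (2 * n)" for m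
      proof (rule AE_I2)
        fix x :: real
        have "0 \<le> (real (Suc m))\<^sup>2 / (x\<^sup>2 + (real (Suc m))\<^sup>2)" by simp
        moreover have "0 < x\<^sup>2 + (real (Suc m))\<^sup>2" by (intro add_nonneg_pos) auto
        then have "(real (Suc m))\<^sup>2 / (x\<^sup>2 + (real (Suc m))\<^sup>2) \<le> 1" by simp
        moreover have "0 \<le> x ^ (2 * n)" by (simp add: power_mult)
        ultimately show "norm (x ^ (2 * n) * ((real (Suc m))\<^sup>2 / (x\<^sup>2 + (real (Suc m))\<^sup>2))) \<le> x ^ (2 * n)"
          by (simp only: real_norm_def abs_mult abs_of_nonneg mult_left_le)
      qed
    qed (use Suc in auto)
    then show ?thesis by (simp only: moment_def R[of "real (Suc m)" for m] of_nat_0_less_iff zero_less_Suc)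
  qed
  \<comment> \<open>Uniqueness of expansions identified only the coefficients below 2n; this one is
    the limit of \<open>R\<close>.\<close>
  have c_eq: "fps_nth c (2 * n) = moment \<rho> (2 * n)"
  proof (rule LIMSEQ_unique[OF _ lim])
    have "(\<lambda>m. R (real (Suc m)) - fps_nth c (2 * n)) \<longlonglongrightarrow> 0"
    proof (rule Lim_null_comparison)
      show "\<forall>\<^sub>F m in sequentially. norm (R (real (Suc m)) - fps_nth c (2 * n)) \<le> C / (real (Suc m))\<^sup>2"
      proof (rule always_eventually, rule allI)
        fix m
        show "norm (R (real (Suc m)) - fps_nth c (2 * n)) \<le> C / (real (Suc m))\<^sup>2"
          using bound[of "real (Suc m)"] by (simp add: pos_le_divide_eq)
      qed
      show "(\<lambda>m. C / (real (Suc m))\<^sup>2) \<longlonglongrightarrow> 0" by real_asymp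
    qed
    then show "(\<lambda>m. R (real (Suc m))) \<longlonglongrightarrow> fps_nth c (2 * n)" by (simp add: LIM_zero_iff)
  qed
  \<comment> \<open>As x^2 y^2 / (x^2 + y^2) = y^2 (1 - y^2 / (x^2 + y^2)), the integral of
    \<open>u m\<close> is y^2 times the deviation of \<open>R\<close> from its limit, hence at most
    \<open>C\<close>.\<close>
  define u where "u m x = x ^ (2 * Suc n) * ((real (Suc m))\<^sup>2 / (x\<^sup>2 + (real (Suc m))\<^sup>2))" for m x
  have u_eq: "u m x = (real (Suc m))\<^sup>2 * (x ^ (2 * n) - x ^ (2 * n) * ((real (Suc m))\<^sup>2 / (x\<^sup>2 + (real (Suc m))\<^sup>2)))" for m x
  proof -
    have "x\<^sup>2 + (real (Suc m))\<^sup>2 \<noteq> 0" by (simp add: add_nonneg_eq_0_iff)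
    then show ?thesis by (simp add: u_def divide_simps del: of_nat_Suc) (simp add: algebra_simps power2_eq_square)
  qed
  have u_int: "integrable \<rho> (u m)" for m
    unfolding u_eq[abs_def] by (intro integrable_mult_right Bochner_Integration.integrable_diff Suc R_int) simp
  have u_val: "(\<integral>x. u m x \<partial>\<rho>) \<le> C" for m
  proof -
    have "(\<integral>x. u m x \<partial>\<rho>) = (real (Suc m))\<^sup>2 * (moment \<rho> (2 * n) - R (real (Suc m)))"
      unfolding u_eq integral_mult_right_zero using R[of "real (Suc m)"] R_int[of "real (Suc m)"] Suc
      by (subst Bochner_Integration.integral_diff) (auto simp: moment_def simp del: of_nat_Suc)
    also have "\<dots> \<le> \<bar>R (real (Suc m)) - fps_nth c (2 * n)\<bar> * (real (Suc m))\<^sup>2"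
      unfolding c_eq by (subst mult.commute) (intro mult_right_mono, auto)
    also have "\<dots> \<le> C" by (rule bound) simp
    finally show ?thesis .
  qed
  have u_mono: "u m x \<le> u m' x" if "m \<le> m'" for m m' x
  proof -
    have "(real (Suc m))\<^sup>2 \<le> (real (Suc m'))\<^sup>2" using that by (intro power_mono) auto
    moreover have "x\<^sup>2 + (real (Suc m))\<^sup>2 > 0" "x\<^sup>2 + (real (Suc m'))\<^sup>2 > 0"
      by (simp_all add: add_nonneg_pos)
    ultimately have "(real (Suc m))\<^sup>2 / (x\<^sup>2 + (real (Suc m))\<^sup>2) \<le> (real (Suc m'))\<^sup>2 / (x\<^sup>2 + (real (Suc m'))\<^sup>2)"
      by (simp add: frac_le_eq divide_le_0_iff algebra_simps mult_left_mono del: of_nat_Suc)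
    moreover have "0 \<le> x ^ (2 * Suc n)" by (simp only: power_mult zero_le_power zero_le_power2)
    ultimately show ?thesis unfolding u_def by (rule mult_left_mono)
  qed
  have "incseq (\<lambda>m. \<integral>x. u m x \<partial>\<rho>)"
    by (intro incseq_SucI integral_mono u_int u_mono) simp
  then obtain L where L: "(\<lambda>m. \<integral>x. u m x \<partial>\<rho>) \<longlonglongrightarrow> L"
    using incseq_convergent[of "\<lambda>m. \<integral>x. u m x \<partial>\<rho>" C] u_val by blast
  show ?case
  proof (rule integrable_monotone_convergence[OF _ _ _ L])
    show "AE x in \<rho>. mono (\<lambda>m. u m x)" using u_mono by (auto simp: mono_def)
    show "AE x in \<rho>. (\<lambda>m. u m x) \<longlonglongrightarrow> x ^ (2 * Suc n)"
    proof (rule AE_I2)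
      fix x :: real
      have "(\<lambda>m. (real (Suc m))\<^sup>2 / (x\<^sup>2 + (real (Suc m))\<^sup>2)) \<longlonglongrightarrow> 1" by real_asymp
      from tendsto_mult_left[OF this, of "x ^ (2 * Suc n)"]
      show "(\<lambda>m. u m x) \<longlonglongrightarrow> x ^ (2 * Suc n)" by (simp add: u_def)
    qed
  qed (use u_int in auto)
qed

theorem Hamburger_moments:
  assumes "real_prob \<rho>" "\<And>N. expands N (moment_rem \<rho> 0) (of_real_fps c)"
  shows "has_all_moments \<rho>" and "moment \<rho> k = fps_nth c k"
proof -
  have int: "integrable \<rho> (\<lambda>x. x ^ k)" for k
    by (rule integrable_power_le_even[OF assms(1) integrable_even_power[OF assms, of k]]) simp
  then show "has_all_moments \<rho>" by (simp add: has_all_moments_def)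
  show "moment \<rho> k = fps_nth c k"
    using expands_unique[OF assms(2)[of "Suc k"] expands_moment_rem[OF assms(1), of 0 "Suc k"], of k] int
    by (simp add: moment_fps_def)
qed

text \<open>A finite geometric series with exact remainder, at a general point of the upper
  half-plane: it is applied at H(iy), which need not lie on the imaginary axis.\<close>

lemma cauchy_tr_partial_expansion:
  assumes \<mu>: "real_prob \<mu>" "has_all_moments \<mu>" and z: "Im z > 0"
  shows "cauchy_tr \<mu> z = (\<Sum>k<N. of_real (moment \<mu> k) * (1 / z) ^ Suc k) +
      (1 / z) ^ N * (\<integral>x. complex_of_real (x ^ N) / (z - of_real x) \<partial>\<mu>)"
    and "norm (\<integral>x. complex_of_real (x ^ N) / (z - of_real x) \<partial>\<mu>) \<le> (\<integral>x. \<bar>x ^ N\<bar> \<partial>\<mu>) / Im z"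
proof -
  interpret real_distribution \<mu> using \<mu> by (simp add: real_prob_iff)
  have mom: "integrable \<mu> (\<lambda>x. x ^ k)" for k using \<mu>(2) by (simp add: has_all_moments_def)
  have le: "norm (complex_of_real (x ^ k) / (z - of_real x)) \<le> \<bar>x ^ k\<bar> / Im z" for k x
  proof -
    have "norm (complex_of_real (x ^ k) / (z - of_real x)) = \<bar>x ^ k\<bar> * norm (1 / (z - of_real x))"
      by (simp only: norm_divide norm_of_real norm_one) simp
    also have "\<dots> \<le> \<bar>x ^ k\<bar> * (1 / Im z)"
      by (intro mult_left_mono norm_resolvent_le z) auto
    finally show ?thesis by simp
  qed
  have bnd: "integrable \<mu> (\<lambda>x. \<bar>x ^ k\<bar> / Im z)" for k using mom[of k] by (intro integrable_divide integrable_abs)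
  have int: "integrable \<mu> (\<lambda>x. complex_of_real (x ^ k) / (z - of_real x))" for k
    by (rule Bochner_Integration.integrable_bound[OF bnd[of k]]) (use le z in auto)
  have "norm (\<integral>x. complex_of_real (x ^ N) / (z - of_real x) \<partial>\<mu>)
      \<le> (\<integral>x. norm (complex_of_real (x ^ N) / (z - of_real x)) \<partial>\<mu>)"
    by (rule integral_norm_bound)
  also have "\<dots> \<le> (\<integral>x. \<bar>x ^ N\<bar> / Im z \<partial>\<mu>)"
    by (intro integral_mono integrable_norm int bnd le)
  finally show "norm (\<integral>x. complex_of_real (x ^ N) / (z - of_real x) \<partial>\<mu>) \<le> (\<integral>x. \<bar>x ^ N\<bar> \<partial>\<mu>) / Im z"
    by simp
  have z0: "z \<noteq> 0" using z by auto
  show "cauchy_tr \<mu> z = (\<Sum>k<N. of_real (moment \<mu> k) * (1 / z) ^ Suc k) +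
      (1 / z) ^ N * (\<integral>x. complex_of_real (x ^ N) / (z - of_real x) \<partial>\<mu>)"
  proof (induction N)
    case 0
    show ?case by (simp add: cauchy_tr_def)
  next
    case (Suc N)
    have "(\<integral>x. complex_of_real (x ^ N) / (z - of_real x) \<partial>\<mu>)
        = (\<integral>x. 1 / z * (complex_of_real (x ^ N) + complex_of_real (x ^ Suc N) / (z - of_real x)) \<partial>\<mu>)"
    proof (rule Bochner_Integration.integral_cong[OF refl])
      fix x
      show "complex_of_real (x ^ N) / (z - of_real x)
          = 1 / z * (complex_of_real (x ^ N) + complex_of_real (x ^ Suc N) / (z - of_real x))"
        using z0 resolvent_nz[OF z, of x] by (simp add: field_simps)
    qed
    also have "\<dots> = 1 / z * (of_real (moment \<mu> N) + (\<integral>x. complex_of_real (x ^ Suc N) / (z - of_real x) \<partial>\<mu>))"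
      unfolding integral_mult_right_zero
      by (subst Bochner_Integration.integral_add[OF integrable_of_real[OF mom] int])
        (simp add: moment_def del: of_real_power)
    finally show ?case unfolding Suc.IH by (simp add: algebra_simps)
  qed
qed

text \<open>Since 1 / H(iy) is the inner transform, the outer expansion at H(iy) is a polynomial in
  the inner transform up to a small error. So the convolution has an expansion to every order, given
  by the composed series, and Hamburger's theorem turns it into moments.\<close>

theorem moment_fps_mconv:
  assumes \<mu>: "real_prob \<mu>" "has_all_moments \<mu>" and \<nu>: "real_prob \<nu>" "has_all_moments \<nu>"
  shows "has_all_moments (mconv \<mu> \<nu>)" and "moment_fps (mconv \<mu> \<nu>) = moment_fps \<mu> oo moment_fps \<nu>"
proof -
  define \<rho> where "\<rho> = mconv \<mu> \<nu>"
  define g where "g = moment_fps \<nu>"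
  define c where "c = moment_fps \<mu> oo g"
  have \<rho>: "real_prob \<rho>" unfolding \<rho>_def by (rule real_prob_mconv[OF \<mu>(1) \<nu>(1)])
  have g0: "fps_nth g 0 = 0" by (simp add: g_def moment_fps_def)
  define \<gamma> where "\<gamma> y = cauchy_tr \<nu> (iy y)" for y
  have exp_\<gamma>: "expands N \<gamma> (of_real_fps g)" for N
  proof -
    have "expands N (\<lambda>y. moment_rem \<nu> 0 y * (1 / iy y)) (of_real_fps (fps_shift (Suc 0) (moment_fps \<nu>)) * fps_X)"
      using \<nu>(2) by (intro expands_mult expands_X expands_moment_rem \<nu>(1)) (simp add: has_all_moments_def)
    then show ?thesis
      by (rule expands_cong) (auto simp: moment_rem_0 \<gamma>_def g_def moment_fps_def fps_mult_fps_X_commute[symmetric] fps_X_mult_nth)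
  qed
  have "expands N (moment_rem \<rho> 0) (of_real_fps (fps_shift 1 c))" for N
  proof -
    define M where "M = (\<integral>x. \<bar>x ^ N\<bar> \<partial>\<mu>)"
    define S where "S y = (\<Sum>k<N. of_real (moment \<mu> k) * \<gamma> y ^ Suc k)" for y
    have "expands (Suc N) S (\<Sum>k<N. fps_const (of_real (moment \<mu> k)) * of_real_fps g ^ Suc k)"
      unfolding S_def by (intro expands_sum expands_cmult expands_power exp_\<gamma>)
    \<comment> \<open>N factors 1 / y come from the power of the inner transform and one more from
      the remainder integral, as the imaginary part of H(iy) is at least y.\<close>
    moreover have "expands (Suc N) (\<lambda>y. cauchy_tr \<rho> (iy y) - S y) 0"
    proof (rule expands_small[where C = M])
      fix y :: real assume y: "y \<ge> 1"
      define H where "H = H_tr \<nu> (iy y)"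
      have Im_iy: "Im (iy y) > 0" using y by simp
      have H: "y \<le> Im H" using Im_H_tr_ge[OF \<nu>(1) Im_iy] by (simp add: H_def)
      have Hpos: "Im H > 0" using H y by linarith
      have H_\<gamma>: "1 / H = \<gamma> y" by (simp add: H_def \<gamma>_def H_tr_def)
      have "cauchy_tr \<rho> (iy y) = cauchy_tr \<mu> H"
        unfolding \<rho>_def H_def by (rule cauchy_tr_mconv[OF \<mu>(1) \<nu>(1) Im_iy])
      then have "cauchy_tr \<rho> (iy y) - S y = \<gamma> y ^ N * (\<integral>x. complex_of_real (x ^ N) / (H - of_real x) \<partial>\<mu>)"
        using cauchy_tr_partial_expansion(1)[OF \<mu> Hpos, of N] by (simp add: H_\<gamma> S_def)
      moreover have "norm (\<gamma> y) \<le> 1 / y" using norm_cauchy_tr_le[OF \<nu>(1) Im_iy] by (simp add: \<gamma>_def)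
      then have "norm (\<gamma> y ^ N) \<le> (1 / y) ^ N" unfolding norm_power by (rule power_mono) simp
      moreover have "norm (\<integral>x. complex_of_real (x ^ N) / (H - of_real x) \<partial>\<mu>) \<le> M / y"
      proof -
        have "norm (\<integral>x. complex_of_real (x ^ N) / (H - of_real x) \<partial>\<mu>) \<le> M / Im H"
          unfolding M_def by (rule cauchy_tr_partial_expansion(2)[OF \<mu> Hpos])
        also have "\<dots> \<le> M / y" using H y by (intro divide_left_mono) (auto simp: M_def)
        finally show ?thesis .
      qed
      ultimately have "norm (cauchy_tr \<rho> (iy y) - S y) \<le> (1 / y) ^ N * (M / y)"
        using y by (simp only: norm_mult) (intro mult_mono, auto)
      then show "norm (cauchy_tr \<rho> (iy y) - S y) \<le> M / y ^ Suc N"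
        by (simp add: power_one_over field_simps)
    qed
    ultimately have "expands (Suc N) (\<lambda>y. S y + (cauchy_tr \<rho> (iy y) - S y))
        ((\<Sum>k<N. fps_const (of_real (moment \<mu> k)) * of_real_fps g ^ Suc k) + 0)"
      by (rule expands_add)
    then have "expands (Suc N) (\<lambda>y. cauchy_tr \<rho> (iy y)) (of_real_fps c)"
    proof (rule expands_cong)
      fix n assume n: "n < Suc N"
      have "fps_nth c n = (\<Sum>i=0..n. fps_nth (moment_fps \<mu>) i * fps_nth (g ^ i) n)"
        by (simp add: c_def fps_compose_nth)
      \<comment> \<open>The added terms vanish because \<open>g ^ i\<close> has no coefficient below
        degree i.\<close>
      also have "\<dots> = (\<Sum>i=0..N. fps_nth (moment_fps \<mu>) i * fps_nth (g ^ i) n)"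
        by (rule sum.mono_neutral_left) (use n startsby_zero_power_prefix[OF g0] in auto)
      also have "\<dots> = (\<Sum>k<N. moment \<mu> k * fps_nth (g ^ Suc k) n)"
        unfolding atLeast0AtMost lessThan_Suc_atMost[symmetric] sum.lessThan_Suc_shift
        by (simp add: moment_fps_def)
      finally show "fps_nth ((\<Sum>k<N. fps_const (of_real (moment \<mu> k)) * of_real_fps g ^ Suc k) + 0) n
          = fps_nth (of_real_fps c) n"
        by (simp add: fps_sum_nth of_real_fps_power[symmetric] of_real_fps_mult[symmetric])
    qed simp
    \<comment> \<open>Multiplication by iy costs one order, which is why the expansion was taken to
      order \<open>Suc N\<close>.\<close>
    then have "expands N (\<lambda>y. cauchy_tr \<rho> (iy y) * iy y) (fps_shift 1 (of_real_fps c))"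
      by (simp add: c_def moment_fps_def)
    then show ?thesis by (rule expands_cong) (auto simp: moment_rem_0)
  qed
  note ham = Hamburger_moments[OF \<rho> this]
  show "has_all_moments (mconv \<mu> \<nu>)" using ham(1) by (simp add: \<rho>_def)
  have "moment_fps \<rho> = c"
  proof (rule fps_ext)
    fix n
    show "fps_nth (moment_fps \<rho>) n = fps_nth c n"
      using ham(2) by (cases n) (auto simp: moment_fps_def c_def)
  qed
  then show "moment_fps (mconv \<mu> \<nu>) = moment_fps \<mu> oo moment_fps \<nu>" by (simp add: \<rho>_def c_def g_def)
qed

section \<open>Monotone partitions\<close>

text \<open>The list alone carries the pair, its set being the partition. The ground set is
  arbitrary because deleting the last block leaves a set with a gap, and the length is fixed because
  it enters the weight as \<open>fact k\<close>.\<close>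

definition mono_lists :: "nat set \<Rightarrow> nat \<Rightarrow> nat set list set" where
  "mono_lists S k = {xs. length xs = k \<and> distinct xs \<and> partition_on S (set xs) \<and>
    noncrossing (set xs) \<and> sorted_wrt (\<lambda>V W. \<not> inner_side V W) xs}"

definition block_weight :: "(nat \<Rightarrow> real) \<Rightarrow> nat set list \<Rightarrow> real" where
  "block_weight r xs = (\<Prod>V\<leftarrow>xs. r (card V))"

definition total_weight :: "(nat \<Rightarrow> real) \<Rightarrow> nat set \<Rightarrow> nat \<Rightarrow> real" where
  "total_weight r S k = (\<Sum>xs\<in>mono_lists S k. block_weight r xs)"

lemma finite_mono_lists:
  assumes "finite S"
  shows "finite (mono_lists S k)"
proof (rule finite_subset)
  show "mono_lists S k \<subseteq> {xs. set xs \<subseteq> Pow S \<and> length xs = k}"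
    by (auto simp: mono_lists_def partition_on_def)
qed (use assms in \<open>simp add: finite_lists_length_eq\<close>)

lemma inner_side_irrefl: "V \<noteq> {} \<Longrightarrow> \<not> inner_side V V"
  by (auto simp: inner_side_def)

lemma noncrossingD:
  assumes "noncrossing \<pi>" "V \<in> \<pi>" "W \<in> \<pi>" "V \<noteq> W" "a < b" "b < c" "c < d"
    "a \<in> V" "c \<in> V" "b \<in> W" "d \<in> W"
  shows False
  using assms unfolding noncrossing_def by metis

lemma noncrossing_mono:
  assumes "noncrossing \<pi>" "\<pi>' \<subseteq> \<pi>"
  shows "noncrossing \<pi>'"
  unfolding noncrossing_def[of \<pi>']
proof clarify
  fix V W a b c d
  assume "V \<in> \<pi>'" "W \<in> \<pi>'" "V \<noteq> W" "a < b" "b < c" "c < d" "a \<in> V" "c \<in> V" "b \<in> W" "d \<in> W"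
  then show False using noncrossingD[OF assms(1), of V W a b c d] assms(2) by auto
qed

lemma monotone_partitions_eq:
  "monotone_partitions n = (\<lambda>xs. (set xs, xs)) ` (\<Union>k. mono_lists {1..n} k)"
proof -
  have "(\<forall>i<length xs. \<forall>j<length xs. inner_side (xs ! i) (xs ! j) \<longrightarrow> j < i) \<longleftrightarrow>
      sorted_wrt (\<lambda>V W. \<not> inner_side V W) xs"
    if "partition_on {1..n} (set xs)" for xs
  proof -
    \<comment> \<open>\<open>monotone_partitions\<close> also quantifies over equal indices, where
      the condition says that no block lies inside itself.\<close>
    have "xs ! i \<noteq> {}" if "i < length xs" for i
      using \<open>partition_on {1..n} (set xs)\<close> nth_mem[OF that] by (auto simp: partition_on_def)
    then have irrefl: "\<not> inner_side (xs ! i) (xs ! i)" if "i < length xs" for i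
      using that inner_side_irrefl by blast
    show ?thesis
      unfolding sorted_wrt_iff_nth_less
    proof (intro iffI allI impI)
      fix i j assume "\<forall>i<length xs. \<forall>j<length xs. inner_side (xs ! i) (xs ! j) \<longrightarrow> j < i"
        and "i < j" "j < length xs"
      then show "\<not> inner_side (xs ! i) (xs ! j)" by (meson less_trans less_asym)
    next
      fix i j assume s: "\<forall>i j. i < j \<longrightarrow> j < length xs \<longrightarrow> \<not> inner_side (xs ! i) (xs ! j)"
        and ij: "i < length xs" "j < length xs" "inner_side (xs ! i) (xs ! j)"
      have "i \<noteq> j" using irrefl ij by blast
      moreover have "\<not> i < j" using s ij by blast
      ultimately show "j < i" by simp
    qed
  qed
  then show ?thesis
    by (auto simp: monotone_partitions_def mono_lists_def image_iff)
qed

text \<open>Disjoint nonempty blocks have distinct minima. The bound makes the union over all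
  lengths finite.\<close>

lemma length_mono_lists_le:
  assumes "finite S" "xs \<in> mono_lists S k"
  shows "k \<le> card S"
proof -
  have P: "partition_on S (set xs)" and k: "k = card (set xs)"
    using assms(2) by (auto simp: mono_lists_def distinct_card)
  have fin: "finite V" "V \<noteq> {}" "V \<subseteq> S" if "V \<in> set xs" for V
    using P that assms(1) by (auto simp: partition_on_def intro: finite_subset)
  have "inj_on Min (set xs)"
  proof (rule inj_onI)
    fix V W assume V: "V \<in> set xs" and W: "W \<in> set xs" and "Min V = Min W"
    then have "Min V \<in> V \<inter> W" using fin by (metis Min_in IntI)
    then show "V = W" using P V W by (auto simp: partition_on_def disjoint_def)
  qed
  moreover have "Min ` set xs \<subseteq> S" using fin by (auto intro!: subsetD[OF fin(3)])
  ultimately show ?thesis unfolding k using assms(1) by (rule card_inj_on_le)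
qed

lemma sum_monotone_partitions:
  "(\<Sum>(\<pi>, xs)\<in>monotone_partitions n. (\<Prod>V\<in>\<pi>. r (card V)) / fact (card \<pi>))
    = (\<Sum>k\<le>n. total_weight r {1..n} k / fact k)"
proof -
  have U: "(\<Union>k. mono_lists {1..n} k) = (\<Union>k\<le>n. mono_lists {1..n} k)"
    using length_mono_lists_le[of "{1..n}"] by fastforce
  have "(\<Sum>(\<pi>, xs)\<in>monotone_partitions n. (\<Prod>V\<in>\<pi>. r (card V)) / fact (card \<pi>))
      = (\<Sum>xs\<in>(\<Union>k\<le>n. mono_lists {1..n} k). (\<Prod>V\<in>set xs. r (card V)) / fact (card (set xs)))"
    unfolding monotone_partitions_eq U by (subst sum.reindex) (auto simp: inj_on_def)
  also have "\<dots> = (\<Sum>k\<le>n. \<Sum>xs\<in>mono_lists {1..n} k. (\<Prod>V\<in>set xs. r (card V)) / fact (card (set xs)))"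
    by (intro sum.UNION_disjoint ballI finite_mono_lists) (auto simp: mono_lists_def)
  also have "\<dots> = (\<Sum>k\<le>n. \<Sum>xs\<in>mono_lists {1..n} k. block_weight r xs / fact k)"
    by (intro sum.cong refl)
      (auto simp: mono_lists_def block_weight_def distinct_card prod.distinct_set_conv_list)
  finally show ?thesis by (simp add: total_weight_def sum_divide_distrib)
qed

lemma mono_lists_relabel:
  assumes h: "strict_mono_on S h" and xs: "xs \<in> mono_lists S k"
  shows "map ((`) h) xs \<in> mono_lists (h ` S) k" and "block_weight r (map ((`) h) xs) = block_weight r xs"
proof -
  have P: "partition_on S (set xs)" using xs by (simp add: mono_lists_def)
  have sub: "V \<subseteq> S" if "V \<in> set xs" for V using P that by (auto simp: partition_on_def)
  have inj: "inj_on h S" using h by (rule strict_mono_on_imp_inj_on)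
  have less: "h x < h y \<longleftrightarrow> x < y" if "x \<in> S" "y \<in> S" for x y
    using h that by (simp add: strict_mono_on_less)
  have injI: "inj_on ((`) h) (set xs)"
    using inj sub by (meson inj_on_image_eq_iff inj_onI)
  have "partition_on (h ` S) (set (map ((`) h) xs))"
  proof -
    have "h ` V \<inter> h ` W = {}" if "V \<in> set xs" "W \<in> set xs" "h ` V \<noteq> h ` W" for V W
    proof -
      have "V \<inter> W = {}" using P that by (auto simp: partition_on_def disjoint_def)
      then show ?thesis using inj_on_image_Int[OF inj sub[OF that(1)] sub[OF that(2)]] by simp
    qed
    then show ?thesis using P by (auto simp: partition_on_def disjoint_def)
  qed
  moreover have "noncrossing (set (map ((`) h) xs))"
    unfolding noncrossing_def
  proof (clarsimp)
    fix V W a b c d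
    assume VW: "V \<in> set xs" "W \<in> set xs" "h ` V \<noteq> h ` W"
      and "h a < h b" "h b < h c" "h c < h d" "a \<in> V" "c \<in> V" "b \<in> W" "d \<in> W"
    then have "a < b" "b < c" "c < d" "V \<noteq> W" using sub less by blast+
    moreover have "noncrossing (set xs)" using xs by (simp add: mono_lists_def)
    ultimately show False using VW \<open>a \<in> V\<close> \<open>c \<in> V\<close> \<open>b \<in> W\<close> \<open>d \<in> W\<close> noncrossingD by metis
  qed
  moreover have "sorted_wrt (\<lambda>V W. \<not> inner_side V W) (map ((`) h) xs)"
    unfolding sorted_wrt_map
  proof (rule sorted_wrt_mono_rel)
    show "sorted_wrt (\<lambda>V W. \<not> inner_side V W) xs" using xs by (simp add: mono_lists_def)
    fix V W assume VW: "V \<in> set xs" "W \<in> set xs" "\<not> inner_side V W"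
    show "\<not> inner_side (h ` V) (h ` W)"
    proof
      assume "inner_side (h ` V) (h ` W)"
      then obtain w1 w2 where "w1 \<in> W" "w2 \<in> W" "\<forall>v\<in>V. h w1 < h v \<and> h v < h w2"
        by (auto simp: inner_side_def)
      then have "\<forall>v\<in>V. w1 < v \<and> v < w2" using sub[OF VW(1)] sub[OF VW(2)] less by blast
      then show False using VW(3) \<open>w1 \<in> W\<close> \<open>w2 \<in> W\<close> by (auto simp: inner_side_def)
    qed
  qed
  ultimately show "map ((`) h) xs \<in> mono_lists (h ` S) k"
    using xs injI by (simp add: mono_lists_def distinct_map)
  have "card (h ` V) = card V" if "V \<in> set xs" for V
    by (rule card_image) (rule inj_on_subset[OF inj sub[OF that]])
  then show "block_weight r (map ((`) h) xs) = block_weight r xs"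
    unfolding block_weight_def by (simp add: o_def cong: map_cong)
qed

text \<open>The weight depends only on the order type of the ground set, so the gap left by a
  deleted interval can be closed.\<close>

lemma total_weight_relabel:
  assumes h: "strict_mono_on S h"
  shows "total_weight r (h ` S) k = total_weight r S k"
proof -
  let ?g = "the_inv_into S h"
  have inj: "inj_on h S" using h by (rule strict_mono_on_imp_inj_on)
  have g: "strict_mono_on (h ` S) ?g"
    using h by (auto simp: strict_mono_on_def the_inv_into_f_f[OF inj])
      (metis h strict_mono_on_less)
  have gh: "?g ` h ` S = S" using inj by (auto simp: the_inv_into_f_f image_iff)
  have id1: "map ((`) ?g) (map ((`) h) xs) = xs" if "xs \<in> mono_lists S k" for xs
  proof -
    have "?g ` h ` V = V" if "V \<in> set xs" for V
    proof -
      have "V \<subseteq> S" using \<open>xs \<in> mono_lists S k\<close> that by (auto simp: mono_lists_def partition_on_def)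
      then have "(\<lambda>x. ?g (h x)) ` V = (\<lambda>x. x) ` V"
        by (intro image_cong refl) (auto simp: the_inv_into_f_f[OF inj])
      then show ?thesis by (simp add: image_image)
    qed
    then show ?thesis by (simp add: map_idI)
  qed
  have id2: "map ((`) h) (map ((`) ?g) xs) = xs" if "xs \<in> mono_lists (h ` S) k" for xs
  proof -
    have "h ` ?g ` V = V" if "V \<in> set xs" for V
    proof -
      have "V \<subseteq> h ` S" using \<open>xs \<in> mono_lists (h ` S) k\<close> that by (auto simp: mono_lists_def partition_on_def)
      then have "(\<lambda>x. h (?g x)) ` V = (\<lambda>x. x) ` V"
        by (intro image_cong refl) (meson f_the_inv_into_f[OF inj] subsetD)
      then show ?thesis by (simp add: image_image)
    qed
    then show ?thesis by (simp add: map_idI)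
  qed
  show ?thesis
    unfolding total_weight_def
    by (rule sum.reindex_bij_witness[where i = "map ((`) h)" and j = "map ((`) ?g)"])
      (use id1 id2 mono_lists_relabel[OF h] mono_lists_relabel[OF g] in \<open>auto simp: gh simp del: map_map\<close>)
qed

text \<open>The last block encloses no other block, so it is an interval; conversely an interval can always be
  appended.\<close>

lemma mono_lists_snoc:
  "xs @ [V] \<in> mono_lists {1..n} (Suc k) \<longleftrightarrow>
    (\<exists>i\<in>{1..n}. \<exists>a\<in>{0..n - i}. V = {a + 1..a + i} \<and> xs \<in> mono_lists ({1..n} - {a + 1..a + i}) k)"
  (is "?L \<longleftrightarrow> ?R")
proof
  assume L: ?L
  then have P: "partition_on {1..n} (insert V (set xs))" and V: "V \<notin> set xs" and dis: "distinct xs"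
    and nc: "noncrossing (insert V (set xs))" and len: "length xs = k"
    and so: "sorted_wrt (\<lambda>V W. \<not> inner_side V W) xs" "\<And>W. W \<in> set xs \<Longrightarrow> \<not> inner_side W V"
    by (auto simp: mono_lists_def sorted_wrt_append)
  have V0: "V \<noteq> {}" "V \<subseteq> {1..n}" using P by (auto simp: partition_on_def)
  have finV: "finite V" using V0 finite_subset by blast
  define l u where "l = Min V" and "u = Max V"
  have lu: "l \<in> V" "u \<in> V" "\<And>v. v \<in> V \<Longrightarrow> l \<le> v \<and> v \<le> u"
    using finV V0 by (auto simp: l_def u_def)
  have disj: "V \<inter> W = {}" if "W \<in> set xs" for W
    using P V that by (auto simp: partition_on_def disjoint_def)
  have between: "x \<in> V" if x: "l \<le> x" "x \<le> u" for x
  proof (rule ccontr)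
    assume nx: "x \<notin> V"
    then have lx: "l < x" "x < u" using x lu by (metis le_neq_implies_less)+
    have "x \<in> {1..n}" using lx lu V0 by fastforce
    then have "x \<in> \<Union> (insert V (set xs))" using partition_onD1[OF P] by argo
    then obtain W where W: "W \<in> set xs" "x \<in> W" using nx by blast
    have "V \<noteq> W" using V W by auto
    \<comment> \<open>A block with a point in a gap of \<open>V\<close> and another outside [l, u]
      would cross \<open>V\<close> at l and u. So it lies on the inner side of \<open>V\<close>,
      which is impossible as \<open>V\<close> is last.\<close>
    have "l < y \<and> y < u" if y: "y \<in> W" for y
    proof (rule ccontr)
      assume "\<not> (l < y \<and> y < u)"
      moreover have "y \<noteq> l" "y \<noteq> u" using y disj[OF W(1)] lu by auto
      ultimately consider "y < l" | "u < y" by linarith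
      then show False
      proof cases
        case 1
        then show False
          using noncrossingD[OF nc, of W V y l x u] lx lu W y \<open>V \<noteq> W\<close> by simp
      next
        case 2
        then show False
          using noncrossingD[OF nc, of V W l x u y] lx lu W y \<open>V \<noteq> W\<close> by simp
      qed
    qed
    then have "inner_side W V" using lu unfolding inner_side_def by blast
    then show False using so(2)[OF W(1)] by simp
  qed
  have V_eq: "V = {l..u}"
  proof (intro equalityI subsetI)
    fix x assume "x \<in> V"
    then show "x \<in> {l..u}" using lu(3)[of x] by simp
  qed (simp add: between)
  have l1: "1 \<le> l" "u \<le> n" "l \<le> u" using lu V0 by auto
  define a i where "a = l - 1" and "i = u - a"
  have ai: "V = {a + 1..a + i}" "i \<in> {1..n}" "a \<in> {0..n - i}"
    using l1 V_eq by (auto simp: a_def i_def)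
  have "partition_on ({1..n} - V) (set xs)"
  proof (rule partition_onI)
    show "\<Union> (set xs) = {1..n} - V"
      using P disj by (auto simp: partition_on_def)
    show "disjnt p q" if "p \<in> set xs" "q \<in> set xs" "p \<noteq> q" for p q
      using P that by (auto simp: partition_on_def disjoint_def disjnt_def)
    show "{} \<notin> set xs" using P by (auto simp: partition_on_def)
  qed
  moreover have "noncrossing (set xs)" using noncrossing_mono[OF nc] by blast
  ultimately have "xs \<in> mono_lists ({1..n} - V) k" using so dis len by (simp add: mono_lists_def)
  then show ?R using ai by blast
next
  assume ?R
  then obtain i a where i: "i \<in> {1..n}" "a \<in> {0..n - i}" and V: "V = {a + 1..a + i}"
    and xs: "xs \<in> mono_lists ({1..n} - V) k" by blast
  have P: "partition_on ({1..n} - V) (set xs)" using xs by (simp add: mono_lists_def)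
  have V0: "V \<noteq> {}" "V \<subseteq> {1..n}" using i V by auto
  have sub: "W \<subseteq> {1..n} - V" "W \<noteq> {}" if "W \<in> set xs" for W
    using P that by (auto simp: partition_on_def)
  have "V \<notin> set xs" using sub V0 by blast
  moreover have "partition_on {1..n} (insert V (set xs))"
  proof (rule partition_onI)
    show "\<Union> (insert V (set xs)) = {1..n}" using P V0 by (auto simp: partition_on_def)
    show "disjnt p q" if "p \<in> insert V (set xs)" "q \<in> insert V (set xs)" "p \<noteq> q" for p q
      using partition_onD2[OF P] that sub(1) unfolding disjoint_def disjnt_def by blast
    show "{} \<notin> insert V (set xs)" using sub V0 by auto
  qed
  moreover have conv: "x \<in> V" if "a \<in> V" "b \<in> V" "a < x" "x < b" for x a b
    using that by (simp add: V)
  have "noncrossing (insert V (set xs))"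
    unfolding noncrossing_def
  proof (clarify)
    fix A B a b c d
    assume AB: "A \<in> insert V (set xs)" "B \<in> insert V (set xs)" "A \<noteq> B"
      and lt: "a < b" "b < c" "c < d" and mem: "a \<in> A" "c \<in> A" "b \<in> B" "d \<in> B"
    consider "A = V" "B \<in> set xs" | "B = V" "A \<in> set xs" | "A \<in> set xs" "B \<in> set xs"
      using AB by blast
    then show False
    proof cases
      case 1
      then show False using conv[of a c b] lt mem sub by blast
    next
      case 2
      then show False using conv[of b d c] lt mem sub by blast
    next
      case 3
      moreover have "noncrossing (set xs)" using xs by (simp add: mono_lists_def)
      ultimately show False using noncrossingD[of "set xs" A B a b c d] AB(3) lt mem by simp
    qed
  qed
  moreover have "\<not> inner_side W V" if "W \<in> set xs" for W
    using sub[OF that] conv unfolding inner_side_def by blast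
  ultimately show ?L using xs by (simp add: mono_lists_def sorted_wrt_append)
qed

lemma total_weight_Suc:
  "total_weight r {1..n} (Suc k) = (\<Sum>i=1..n. real (n - i + 1) * r i * total_weight r {1..n - i} k)"
proof -
  \<comment> \<open>Here i is the size of the last block and a the number of points to its left,
    which leaves n - i + 1 positions.\<close>
  define J where "J = Sigma {1..n} (\<lambda>i. {0..n - i})"
  define X where "X = (\<lambda>(i::nat, a::nat). mono_lists ({1..n} - {a + 1..a + i}) k)"
  define f where "f = (\<lambda>((i::nat, a::nat), xs). xs @ [{a + 1..a + i}])"
  have img: "mono_lists {1..n} (Suc k) = f ` Sigma J X"
  proof (rule Set.set_eqI)
    fix ys
    show "ys \<in> mono_lists {1..n} (Suc k) \<longleftrightarrow> ys \<in> f ` Sigma J X"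
    proof (cases ys rule: rev_cases)
      case Nil
      then show ?thesis by (auto simp: mono_lists_def f_def)
    next
      case (snoc xs V)
      show ?thesis unfolding snoc mono_lists_snoc by (auto simp: f_def J_def X_def image_iff)
    qed
  qed
  have inj: "inj_on f (Sigma J X)"
  proof (rule inj_onI)
    fix p q assume p: "p \<in> Sigma J X" and q: "q \<in> Sigma J X" and eq: "f p = f q"
    obtain i a xs i' a' ys where pq: "p = ((i, a), xs)" "q = ((i', a'), ys)"
      by (metis surj_pair)
    \<comment> \<open>An empty interval would not determine its position.\<close>
    have "i \<ge> 1" "i' \<ge> 1" using p q pq by (auto simp: J_def)
    moreover have "{a + 1..a + i} = {a' + 1..a' + i'}" "xs = ys" using eq by (auto simp: pq f_def)
    ultimately show "p = q" unfolding pq by (auto simp: Icc_eq_Icc)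
  qed
  have "total_weight r {1..n} (Suc k) = (\<Sum>(ia, xs)\<in>Sigma J X. block_weight r (f (ia, xs)))"
    unfolding total_weight_def img by (subst sum.reindex[OF inj]) (simp add: case_prod_beta)
  also have "\<dots> = (\<Sum>ia\<in>J. \<Sum>xs\<in>X ia. block_weight r (f (ia, xs)))"
    by (rule sum.Sigma[symmetric]) (auto simp: J_def X_def intro!: finite_mono_lists)
  also have "\<dots> = (\<Sum>(i, a)\<in>J. r i * total_weight r {1..n - i} k)"
  proof (intro sum.cong refl, clarify)
    fix i a assume "(i, a) \<in> J"
    then have ia: "i \<in> {1..n}" "a \<in> {0..n - i}" by (auto simp: J_def)
    \<comment> \<open>The order isomorphism that opens a gap of length i after the first a
      points.\<close>
    let ?h = "\<lambda>x. if x \<le> a then x else x + i"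
    have h: "?h ` {1..n - i} = {1..n} - {a + 1..a + i}"
    proof (intro equalityI subsetI)
      fix x assume x: "x \<in> {1..n} - {a + 1..a + i}"
      then have "x = ?h (if x \<le> a then x else x - i)" "(if x \<le> a then x else x - i) \<in> {1..n - i}"
        using ia by auto
      then show "x \<in> ?h ` {1..n - i}" by blast
    qed (use ia in auto)
    have mono: "strict_mono_on {1..n - i} ?h" by (auto simp: strict_mono_on_def)
    have "(\<Sum>xs\<in>X (i, a). block_weight r (f ((i, a), xs)))
        = r i * total_weight r ({1..n} - {a + 1..a + i}) k"
      by (simp add: X_def f_def block_weight_def total_weight_def sum_distrib_left mult.commute)
    then show "(\<Sum>xs\<in>X (i, a). block_weight r (f ((i, a), xs))) = r i * total_weight r {1..n - i} k"
      using total_weight_relabel[OF mono, of r k] unfolding h by simp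
  qed
  also have "\<dots> = (\<Sum>i=1..n. \<Sum>a=0..n - i. r i * total_weight r {1..n - i} k)"
    unfolding J_def by (rule sum.Sigma[symmetric]) auto
  finally show ?thesis by (simp add: mult.assoc)
qed

lemma total_weight_0: "total_weight r {1..n} 0 = (if n = 0 then 1 else 0)"
proof -
  have "mono_lists {1..n} 0 = (if n = 0 then {[]} else {})"
    by (auto simp: mono_lists_def partition_on_def noncrossing_def)
  then show ?thesis by (simp add: total_weight_def block_weight_def)
qed

lemma total_weight_gt:
  assumes "k > n"
  shows "total_weight r {1..n} k = 0"
proof -
  have "mono_lists {1..n} k = {}" using length_mono_lists_le[of "{1..n}" _ k] assms by fastforce
  then show ?thesis by (simp add: total_weight_def)
qed

text \<open>The exponential generating polynomials of the total weights satisfy the same differential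
  equations as the moments of the monotone convolution semigroup.\<close>

lemma poly_ode_sum_total_weight:
  fixes P :: "nat \<Rightarrow> real poly"
  assumes P0: "\<And>n. poly (P n) 0 = (if n = 0 then 1 else 0)"
    and ode: "\<And>n. pderiv (P n) = (\<Sum>k<n. smult (real (k + 1) * r (n - k)) (P k))"
  shows "poly (P n) 1 = (\<Sum>k\<le>n. total_weight r {1..n} k / fact k)"
proof -
  \<comment> \<open>Comparing coefficients in the differential equation gives the recursion for
    removing the last block, with j = n - i points left; the division by k + 1 at each block builds
    up the factorial.\<close>
  have c: "poly.coeff (P n) k = total_weight r {1..n} k / fact k" for n k
  proof (induction k arbitrary: n)
    case 0
    show ?case using P0[of n] total_weight_0[of r n] by (simp add: poly_0_coeff_0)
  next
    case (Suc k)
    have "real (Suc k) * poly.coeff (P n) (Suc k) = (\<Sum>j<n. real (j + 1) * r (n - j) * poly.coeff (P j) k)"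
      using arg_cong[OF ode[of n], of "\<lambda>p. poly.coeff p k"] by (simp add: coeff_pderiv coeff_sum)
    also have "\<dots> = (\<Sum>j<n. real (j + 1) * r (n - j) * total_weight r {1..j} k) / fact k"
      by (simp add: Suc.IH sum_divide_distrib)
    also have "(\<Sum>j<n. real (j + 1) * r (n - j) * total_weight r {1..j} k)
        = (\<Sum>i=1..n. real (n - i + 1) * r i * total_weight r {1..n - i} k)"
      by (rule sum.reindex_bij_witness[where i = "\<lambda>i. n - i" and j = "\<lambda>j. n - j"]) auto
    also have "\<dots> = total_weight r {1..n} (Suc k)" by (rule total_weight_Suc[symmetric])
    finally have "real (Suc k) * poly.coeff (P n) (Suc k) = total_weight r {1..n} (Suc k) / fact k" .
    then have "poly.coeff (P n) (Suc k) = total_weight r {1..n} (Suc k) / fact k / real (Suc k)"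
      by (metis nonzero_mult_div_cancel_left of_nat_neq_0)
    then show ?case by (simp del: of_nat_Suc add: mult.commute)
  qed
  have "degree (P n) \<le> n"
  proof (rule degree_le, intro allI impI)
    fix i assume "n < i"
    then show "poly.coeff (P n) i = 0" using total_weight_gt[of n i r] c[of n i] by simp
  qed
  then have "poly (P n) 1 = (\<Sum>k\<le>n. poly.coeff (P n) k)"
    unfolding poly_altdef by simp (rule sum.mono_neutral_left, auto simp: coeff_eq_0)
  then show ?thesis by (simp add: c)
qed

section \<open>Iterated composition of power series\<close>

text \<open>Stands in for real exponents: identities in t are verified where iterates exist. The
  offset \<open>N0\<close> allows for \<open>mcumulant\<close>, which prescribes values only from 1
  on.\<close>

lemma poly_eq_on_nats:
  fixes p q :: "real poly"
  assumes "\<And>N. N \<ge> N0 \<Longrightarrow> poly p (real N) = poly q (real N)"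
  shows "p = q"
proof (rule ccontr)
  assume "p \<noteq> q"
  then have "finite {x. poly (p - q) x = 0}" by (intro poly_roots_finite) simp
  moreover have "real ` {N0..} \<subseteq> {x. poly (p - q) x = 0}" using assms by auto
  ultimately have "finite (real ` {N0..})" by (rule finite_subset[rotated])
  then show False by (simp add: finite_image_iff infinite_Ici)
qed

lemma binomial_poly: "\<exists>p. \<forall>N. poly p (real N) = real (N choose k)"
proof (intro exI allI)
  fix N
  show "poly (smult (1 / fact k) (\<Prod>i=0..<k. [:- real i, 1:])) (real N) = real (N choose k)"
    by (simp add: binomial_gbinomial gbinomial_prod_rev poly_prod)
qed

text \<open>Newton's forward difference formula, \<open>b j\<close> being the \<open>j\<close>-th difference of \<open>b 0\<close>.\<close>

lemma newton_forward:
  fixes b :: "nat \<Rightarrow> nat \<Rightarrow> real"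
  assumes step: "\<And>j N. b j (Suc N) = b j N + b (Suc j) N" and zero: "\<And>j N. j > m \<Longrightarrow> b j N = 0"
  shows "b j N = (\<Sum>k\<le>m. real (N choose k) * b (j + k) 0)"
proof (induction N arbitrary: j)
  case 0
  have "(\<Sum>k\<le>m. real (0 choose k) * b (j + k) 0) = (\<Sum>k\<le>m. if k = 0 then b j 0 else 0)"
    by (intro sum.cong refl) (auto simp: gr0_conv_Suc)
  then show ?case by simp
next
  case (Suc N)
  have "(\<Sum>k\<le>m. real (Suc N choose k) * b (j + k) 0)
      = b j 0 + (\<Sum>k<m. real (Suc N choose Suc k) * b (j + Suc k) 0)"
    by (simp add: sum.atMost_shift)
  also have "\<dots> = (b j 0 + (\<Sum>k<m. real (N choose Suc k) * b (j + Suc k) 0))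
      + (\<Sum>k<m. real (N choose k) * b (j + Suc k) 0)"
    by (simp add: sum.distrib algebra_simps)
  also have "b j 0 + (\<Sum>k<m. real (N choose Suc k) * b (j + Suc k) 0) = (\<Sum>k\<le>m. real (N choose k) * b (j + k) 0)"
    by (simp add: sum.atMost_shift)
  also have "(\<Sum>k<m. real (N choose k) * b (j + Suc k) 0) = (\<Sum>k\<le>m. real (N choose k) * b (Suc j + k) 0)"
    by (simp add: lessThan_Suc_atMost[symmetric] zero)
  finally show ?case
    unfolding step Suc.IH[of j, symmetric] Suc.IH[of "Suc j", symmetric] by simp
qed

primrec fps_iter :: "real fps \<Rightarrow> nat \<Rightarrow> real fps" where
  "fps_iter g 0 = fps_X"
| "fps_iter g (Suc N) = g oo fps_iter g N"

lemma fps_iter_nth_0: "fps_nth g 0 = 0 \<Longrightarrow> fps_nth (fps_iter g N) 0 = 0"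
  by (cases N) auto

lemma fps_iter_add:
  assumes "fps_nth g 0 = 0"
  shows "fps_iter g (M + N) = fps_iter g M oo fps_iter g N"
proof (induction M)
  case 0
  show ?case by (simp add: fps_iter_nth_0[OF assms])
next
  case (Suc M)
  have "g oo (fps_iter g M oo fps_iter g N) = (g oo fps_iter g M) oo fps_iter g N"
    by (rule fps_compose_assoc) (simp_all add: fps_iter_nth_0[OF assms])
  then show ?case by (simp add: Suc)
qed

lemma fps_iter_nth_1:
  assumes "fps_nth g 0 = 0" "fps_nth g 1 = 1"
  shows "fps_nth (fps_iter g N) 1 = 1"
proof (induction N)
  case (Suc N)
  then show ?case using assms by (simp add: fps_compose_nth)
qed simp

text \<open>Composition with \<open>g = X + O(X\<^sup>2)\<close> is a unipotent operator, so the coefficients of its powers are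
  polynomials in the exponent.\<close>

lemma fps_iter_coeff_poly:
  assumes g: "fps_nth g 0 = 0" "fps_nth g 1 = 1"
  shows "\<exists>p. \<forall>N. poly p (real N) = fps_nth (f oo fps_iter g N) n"
proof -
  \<comment> \<open>The difference operator in the exponent: \<open>K f\<close> composed with the
    N-th iterate is the increment of \<open>f oo fps_iter g N\<close> from N to N + 1.\<close>
  define K where "K f = (f oo g) - f" for f :: "real fps"
  define b where "b j N = fps_nth (((K ^^ j) f) oo fps_iter g N) n" for j N
  have step: "b j (Suc N) = b j N + b (Suc j) N" for j N
  proof -
    let ?h = "(K ^^ j) f"
    have "fps_iter g (Suc N) = g oo fps_iter g N" by simp
    then have "?h oo fps_iter g (Suc N) = (?h oo g) oo fps_iter g N"
      using fps_compose_assoc[of "fps_iter g N" g ?h] by (simp add: fps_iter_nth_0 g)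
    moreover have "K ?h oo fps_iter g N = ((?h oo g) oo fps_iter g N) - (?h oo fps_iter g N)"
      by (simp add: K_def fps_compose_sub_distrib)
    ultimately show ?thesis by (simp add: b_def)
  qed
  \<comment> \<open>Because \<open>g ^ k\<close> starts with X^k, with coefficient 1, the lowest
    term of \<open>f\<close> cancels in \<open>(f oo g) - f\<close>, and each application of
    \<open>K\<close> raises the order.\<close>
  have order: "fps_nth ((K ^^ j) f) i = 0" if "i < j" for i j
    using that
  proof (induction j arbitrary: i)
    case (Suc j)
    let ?h = "(K ^^ j) f"
    have "fps_nth (?h oo g) i = (\<Sum>k=0..i. fps_nth ?h k * fps_nth (g ^ k) i)" by (rule fps_compose_nth)
    also have "\<dots> = (\<Sum>k=0..i. if k = i then fps_nth ?h i * fps_nth (g ^ i) i else 0)"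
      using Suc by (intro sum.cong refl) auto
    also have "\<dots> = fps_nth ?h i" using startsby_zero_power_nth_same[OF g(1), of i] g(2) by simp
    moreover have "K ?h = (?h oo g) - ?h" by (simp add: K_def)
    ultimately show ?case by simp
  qed simp
  have zero: "b j N = 0" if "j > n" for j N
    unfolding b_def fps_compose_nth by (intro sum.neutral ballI) (use order that in auto)
  obtain B where B: "\<And>k N. poly (B k) (real N) = real (N choose k)"
    using binomial_poly by metis
  show ?thesis
  proof (intro exI allI)
    fix N
    show "poly (\<Sum>k\<le>n. smult (b k 0) (B k)) (real N) = fps_nth (f oo fps_iter g N) n"
      using newton_forward[of b, OF step zero, of n 0 N] by (simp add: poly_sum B b_def mult.commute)
  qed
qed

text \<open>In the proof, \<open>q n k\<close> is the derivative at exponent 0 of the coefficient of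
  X^n in the k-th power of the iterate. As the iterate is X there, the k-th power has derivative k
  X^(k-1) times that of the iterate, which is the fact \<open>q\<close>; the semigroup law carries
  this to every exponent.\<close>

theorem fps_iter_ode:
  assumes g: "fps_nth g 0 = 0" "fps_nth g 1 = 1"
  obtains P where "\<And>n N. poly (P n) (real N) = fps_nth (fps_iter g N) (Suc n)"
    and "\<And>n. pderiv (P n) = (\<Sum>k<n. smult (real (k + 1) * poly.coeff (P (n - k)) 1) (P k))"
proof -
  define Q where "Q n k = (SOME p. \<forall>N. poly p (real N) = fps_nth (fps_iter g N ^ k) n)" for n k
  have "\<exists>p. \<forall>N. poly p (real N) = fps_nth (fps_iter g N ^ k) n" for n k
    using fps_iter_coeff_poly[OF g, of "fps_X ^ k" n]
    by (simp only: fps_X_power_compose[OF fps_iter_nth_0[OF g(1)]])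
  from someI_ex[OF this] have Q: "poly (Q n k) (real N) = fps_nth (fps_iter g N ^ k) n" for n k N
    unfolding Q_def by blast
  define q where "q n k = poly.coeff (Q n k) 1" for n k
  have Q0: "poly.coeff (Q n k) 0 = (if n = k then 1 else 0)" for n k
    using Q[of n k 0] by (simp add: poly_0_coeff_0 fps_X_power_nth)
  have const: "q n k = 0" if "\<And>N. fps_nth (fps_iter g N ^ k) n = c" for n k c
  proof -
    have "Q n k = [:c:]" by (rule poly_eq_on_nats) (simp add: Q that)
    then show ?thesis by (simp add: q_def)
  qed
  have q_01: "q 0 (Suc k) = 0" for k by (rule const[of _ _ 0]) (simp add: fps_iter_nth_0[OF g(1)])
  have q_11: "q 1 1 = 0" by (rule const[of _ _ 1]) (simp add: fps_iter_nth_1[OF g, simplified])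
  have q_0: "q n 0 = 0" for n by (rule const[of _ _ "fps_nth 1 n"]) simp
  \<comment> \<open>Leibniz' rule at exponent 0 for the k-th power times one more iterate. Their
    values there are X^k and X, so only the indices i = k and n - i = 1 contribute.\<close>
  have q_Suc: "q n (Suc k) = (if n \<ge> 1 then q (n - 1) k else 0) + (if k \<le> n then q (n - k) 1 else 0)" for n k
  proof -
    have "Q n (Suc k) = (\<Sum>i=0..n. Q i k * Q (n - i) 1)"
    proof (rule poly_eq_on_nats)
      fix N
      show "poly (Q n (Suc k)) (real N) = poly (\<Sum>i=0..n. Q i k * Q (n - i) 1) (real N)"
        by (simp add: Q poly_sum power_Suc2 fps_mult_nth del: power_Suc)
    qed
    moreover have "poly.coeff (Q i k * Q j 1) 1 = (if i = k then q j 1 else 0) + (if j = 1 then q i k else 0)" for i j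
      by (auto simp: coeff_mult Q0 q_def)
    ultimately have "q n (Suc k) = (\<Sum>i=0..n. (if i = k then q (n - i) 1 else 0) + (if n - i = 1 then q i k else 0))"
      by (simp only: q_def[of n "Suc k"] coeff_sum)
    also have "\<dots> = (if k \<le> n then q (n - k) 1 else 0) + (\<Sum>i=0..n. if n - i = 1 then q i k else 0)"
      by (simp add: sum.distrib)
    also have "(\<Sum>i=0..n. if n - i = 1 then q i k else 0) = (if n \<ge> 1 then q (n - 1) k else 0)"
    proof (cases "n \<ge> 1")
      case True
      then have "(\<Sum>i=0..n. if n - i = 1 then q i k else 0) = (\<Sum>i=0..n. if i = n - 1 then q i k else 0)"
        by (intro sum.cong refl) auto
      then show ?thesis using True by simp
    qed simp
    finally show ?thesis by simp
  qed
  have q: "q n k = real k * q (n + 1 - k) 1" if "k \<le> n + 1" for n k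
    using that
  proof (induction k arbitrary: n)
    case (Suc k)
    show ?case
    proof (cases n)
      case 0
      then show ?thesis using Suc.prems by simp
    next
      case (Suc m)
      have "q m k = real k * q (m + 1 - k) 1" using Suc.IH[of m] Suc.prems Suc by simp
      then show ?thesis using q_Suc[of n k] Suc Suc.prems by (simp add: algebra_simps)
    qed
  qed (simp add: q_0)
  define P where "P n = Q (Suc n) 1" for n
  have P: "poly (P n) (real N) = fps_nth (fps_iter g N) (Suc n)" for n N by (simp add: P_def Q)
  have "pderiv (P n) = (\<Sum>k<n. smult (real (k + 1) * poly.coeff (P (n - k)) 1) (P k))" for n
  proof (rule poly_eq_on_nats)
    fix M
    \<comment> \<open>For fixed \<open>M\<close> the semigroup law is an identity of polynomials in
      N. Its linear coefficient is the derivative of \<open>P n\<close> at \<open>M\<close> on the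
      left and a combination of the numbers \<open>q\<close> on the right.\<close>
    have eq: "pcompose (P n) [:real M, 1:] = (\<Sum>i=0..Suc n. smult (fps_nth (fps_iter g M) i) (Q (Suc n) i))"
    proof (rule poly_eq_on_nats)
      fix N
      have "poly (pcompose (P n) [:real M, 1:]) (real N) = poly (P n) (real (M + N))" by (simp add: poly_pcompose)
      then show "poly (pcompose (P n) [:real M, 1:]) (real N)
          = poly (\<Sum>i=0..Suc n. smult (fps_nth (fps_iter g M) i) (Q (Suc n) i)) (real N)"
        unfolding P fps_iter_add[OF g(1)] fps_compose_nth by (simp add: poly_sum Q del: sum.atLeast0_atMost_Suc)
    qed
    have "poly (pderiv (P n)) (real M) = poly (pderiv (pcompose (P n) [:real M, 1:])) 0"
      by (simp add: pderiv_pcompose poly_pcompose pderiv_pCons)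
    also have "\<dots> = poly.coeff (pcompose (P n) [:real M, 1:]) 1"
      by (simp add: poly_0_coeff_0 coeff_pderiv)
    also have "\<dots> = (\<Sum>i=0..Suc n. fps_nth (fps_iter g M) i * q (Suc n) i)"
      unfolding eq by (simp add: coeff_sum q_def del: sum.atLeast0_atMost_Suc)
    also have "\<dots> = (\<Sum>i=0..Suc n. fps_nth (fps_iter g M) i * (real i * q (Suc n + 1 - i) 1))"
      by (intro sum.cong refl) (use q[of _ "Suc n"] in auto)
    also have "\<dots> = (\<Sum>k=0..n. fps_nth (fps_iter g M) (Suc k) * (real (Suc k) * q (n + 1 - k) 1))"
      by (subst sum.atLeast0_atMost_Suc_shift) simp
    \<comment> \<open>The term k = n contains \<open>q 1 1\<close>, which is zero because every
      iterate has linear coefficient 1.\<close>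
    also have "\<dots> = (\<Sum>k<n. fps_nth (fps_iter g M) (Suc k) * (real (Suc k) * q (n + 1 - k) 1))"
      using q_11 by (simp add: atLeast0AtMost lessThan_Suc_atMost[symmetric])
    also have "\<dots> = poly (\<Sum>k<n. smult (real (k + 1) * poly.coeff (P (n - k)) 1) (P k)) (real M)"
      unfolding poly_sum poly_smult P
      by (intro sum.cong refl) (simp add: P_def q_def Suc_diff_le mult_ac)
    finally show "poly (pderiv (P n)) (real M)
        = poly (\<Sum>k<n. smult (real (k + 1) * poly.coeff (P (n - k)) 1) (P k)) (real M)" .
  qed
  then show ?thesis using that P by blast
qed

section \<open>Convolution powers, cumulants and the moment formula\<close>

lemma moments_mpow:
  assumes "real_prob \<mu>" "has_all_moments \<mu>"
  shows "has_all_moments (mpow \<mu> N) \<and> moment_fps (mpow \<mu> N) = fps_iter (moment_fps \<mu>) N"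
proof (induction N)
  case 0
  have "integrable (return borel 0) (\<lambda>x::real. x ^ n)" for n
  proof -
    interpret prob_space "return borel (0::real)" by (rule prob_space_return) simp
    show ?thesis
      by (rule integrable_const_bound[where B = 1]) (auto simp: AE_return power_0_left)
  qed
  moreover have "moment (return borel 0) n = (if n = 0 then 1 else 0)" for n
    unfolding moment_def by (subst integral_return) auto
  ultimately show ?case
    by (auto simp: has_all_moments_def moment_fps_def fps_eq_iff fps_X_def)
next
  case (Suc N)
  then show ?case
    using moment_fps_mconv[OF assms real_prob_mpow[OF assms(1), of N]] by simp
qed

theorem mainTheorem13:
  fixes \<mu> :: "real measure" and n :: nat
  assumes "real_prob \<mu>" and "has_all_moments \<mu>" and "n \<ge> 1"
  shows "moment \<mu> n =
    (\<Sum>(\<pi>, xs)\<in>monotone_partitions n.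
       (\<Prod>V\<in>\<pi>. mcumulant \<mu> (card V)) / fact (card \<pi>))"
proof -
  interpret real_distribution \<mu> using assms(1) by (simp add: real_prob_iff)
  define g where "g = moment_fps \<mu>"
  have "moment \<mu> 0 = 1" by (simp add: moment_def)
  then have g: "fps_nth g 0 = 0" "fps_nth g 1 = 1" by (simp_all add: g_def moment_fps_def)
  obtain P where P: "\<And>n N. poly (P n) (real N) = fps_nth (fps_iter g N) (Suc n)"
    and ode: "\<And>n. pderiv (P n) = (\<Sum>k<n. smult (real (k + 1) * poly.coeff (P (n - k)) 1) (P k))"
    using fps_iter_ode[OF g] by blast
  have P_moment: "poly (P n) (real N) = moment (mpow \<mu> N) n" for n N
  proof -
    have "fps_iter g N = moment_fps (mpow \<mu> N)" using moments_mpow[OF assms(1,2), of N] by (simp add: g_def)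
    then show ?thesis unfolding P by (simp add: moment_fps_def)
  qed
  have r: "mcumulant \<mu> n = poly.coeff (P n) 1" for n
    unfolding mcumulant_def
  proof (rule the_equality)
    show "\<exists>p. (\<forall>N\<ge>1. poly p (real N) = moment (mpow \<mu> N) n) \<and> poly.coeff p 1 = poly.coeff (P n) 1"
      using P_moment by blast
    fix c assume "\<exists>p. (\<forall>N\<ge>1. poly p (real N) = moment (mpow \<mu> N) n) \<and> poly.coeff p 1 = c"
    then obtain p where p: "\<forall>N\<ge>1. poly p (real N) = moment (mpow \<mu> N) n" "poly.coeff p 1 = c" by blast
    \<comment> \<open>The description of \<open>mcumulant\<close> starts at N = 1 while
      \<open>P n\<close> also interpolates at 0; a polynomial is already determined by the values
      from 1 on.\<close>
    have "p = P n" by (rule poly_eq_on_nats[of 1]) (simp add: p(1) P_moment)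
    then show "c = poly.coeff (P n) 1" using p(2) by simp
  qed
  have "moment \<mu> n = poly (P n) 1"
    using P[of n 1] by (simp add: g_def moment_fps_def)
  also have "\<dots> = (\<Sum>k\<le>n. total_weight (mcumulant \<mu>) {1..n} k / fact k)"
  proof (rule poly_ode_sum_total_weight)
    show "poly (P n) 0 = (if n = 0 then 1 else 0)" for n
      using P[of n 0] by (simp add: fps_X_def)
    show "pderiv (P n) = (\<Sum>k<n. smult (real (k + 1) * mcumulant \<mu> (n - k)) (P k))" for n
      unfolding r by (rule ode)
  qed
  finally show ?thesis unfolding sum_monotone_partitions .
qed

end
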